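(* Let $G$ and $K$ be countable graphs with disjoint vertex sets, where $G$ contains no alternating ray and $K$ is finite. Let $\hat G$ be any graph obtained from the disjoint union of $G$ and $K$ by adding an arbitrary set of edges, each with one endpoint in $V(G)$ and the other in $V(K)$. Let $c_K:V(K)\to\{0,1\}$ be any map. Then there is a coloring $\hat c:V(\hat G)\to\{0,1\}$ extending $c_K$ such that $\hat c$ is strongly maximal in $V(G)$ (as a coloring of $\hat G$) and $\hat c$ is unfriendly (in $\hat G$) at every vertex of $V(G)$ of infinite degree.
   Context: Graphs are simple, undirected, possibly infinite; $N(v)$ is the neighborhood, the degree of $v$ is $|N(v)|$ (since $K$ is finite, a vertex of $G$ has finite degree in $G$ iff it has finite degree in $\hat G$). A ray is a one-way infinite path $v_0v_1\dots$; it is alternating if it passes through infinitely many vertices of finite degree and infinitely many of infinite degree. A coloring of a graph $\Gamma$ is a map $c:V(\Gamma)\to\{0,1\}$. It is unfriendly at $v$ if $|\{u\in N(v):c(u)\neq c(v)\}|\ge|\{u\in N(v):c(u)=c(v)\}|$. Let $\mathit{trans}(c)=\{uv\in E(\Gamma):c(u)\neq c(v)\}$; for $F\subseteq V(\Gamma)$ let $c*F$ be the coloring that differs from $c$ exactly on $F$; for a finite set $F$ of vertices of finite degree, $\mathit{dtrans}(c,F)=|\mathit{trans}(c)\setminus\mathit{trans}(c*F)|-|\mathit{trans}(c*F)\setminus\mathit{trans}(c)|$. The coloring $c$ is strongly maximal in $A\subseteq V(\Gamma)$ if $\mathit{dtrans}(c,F)\ge 0$ for every finite set $F\subseteq A$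 consisting of vertices of finite degree. *)

theory Defs
  imports Main "HOL-Library.Extended_Nat" "HOL-Library.Countable_Set"
begin

definition graph :: "'a set \<Rightarrow> ('a \<Rightarrow> 'a \<Rightarrow> bool) \<Rightarrow> bool" where
  "graph V E \<longleftrightarrow> (\<forall>u v. E u v \<longrightarrow> u \<in> V \<and> v \<in> V \<and> u \<noteq> v \<and> E v u)"

definition nbhd :: "('a \<Rightarrow> 'a \<Rightarrow> bool) \<Rightarrow> 'a \<Rightarrow> 'a set" where
  "nbhd E v = {u. E v u}"

text \<open>Cardinality with values in nat plus infinity (faithful for countable sets).\<close>
definition ecard :: "'a set \<Rightarrow> enat" where
  "ecard A = (if finite A then enat (card A) else \<infinity>)"

definition finite_deg :: "('a \<Rightarrow> 'a \<Rightarrow> bool) \<Rightarrow> 'a \<Rightarrow> bool" where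
  "finite_deg E v \<longleftrightarrow> finite (nbhd E v)"

definition alternating_ray :: "'a set \<Rightarrow> ('a \<Rightarrow> 'a \<Rightarrow> bool) \<Rightarrow> (nat \<Rightarrow> 'a) \<Rightarrow> bool" where
  "alternating_ray V E r \<longleftrightarrow>
     inj r \<and> (\<forall>i. r i \<in> V \<and> E (r i) (r (Suc i))) \<and>
     infinite {i. finite_deg E (r i)} \<and> infinite {i. \<not> finite_deg E (r i)}"

definition unfriendly_at :: "('a \<Rightarrow> 'a \<Rightarrow> bool) \<Rightarrow> ('a \<Rightarrow> bool) \<Rightarrow> 'a \<Rightarrow> bool" where
  "unfriendly_at E c v \<longleftrightarrow>
     ecard {u \<in> nbhd E v. c u \<noteq> c v} \<ge> ecard {u \<in> nbhd E v. c u = c v}"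

definition trans_edges :: "('a \<Rightarrow> 'a \<Rightarrow> bool) \<Rightarrow> ('a \<Rightarrow> bool) \<Rightarrow> 'a set set" where
  "trans_edges E c = {{u, v} | u v. E u v \<and> c u \<noteq> c v}"

definition flip :: "('a \<Rightarrow> bool) \<Rightarrow> 'a set \<Rightarrow> ('a \<Rightarrow> bool)" where
  "flip c F = (\<lambda>v. if v \<in> F then \<not> c v else c v)"

definition dtrans :: "('a \<Rightarrow> 'a \<Rightarrow> bool) \<Rightarrow> ('a \<Rightarrow> bool) \<Rightarrow> 'a set \<Rightarrow> int" where
  "dtrans E c F = int (card (trans_edges E c - trans_edges E (flip c F)))
                - int (card (trans_edges E (flip c F) - trans_edges E c))"

definition strongly_maximal :: "('a \<Rightarrow> 'a \<Rightarrow> bool) \<Rightarrow> ('a \<Rightarrow> bool) \<Rightarrow> 'a set \<Rightarrow> bool" where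
  "strongly_maximal E c A \<longleftrightarrow>
     (\<forall>F. finite F \<and> F \<subseteq> A \<and> (\<forall>v\<in>F. finite_deg E v) \<longrightarrow> dtrans E c F \<ge> 0)"

end

theory Submission
  imports Defs
begin

text \<open>Call a vertex set \<open>D\<close> solvable if every coloring of its complement extends to a coloring that is
  strongly maximal in \<open>D\<close> and satisfies the infinite-degree vertices of \<open>D\<close>, and hereditarily solvable
  if \<open>D - X\<close> is solvable for every finite \<open>X\<close>. Since the loss caused by a finite change is bounded,
  strong maximality can be restored by finitely many flips; hence adding finitely many vertices to a
  solvable set keeps it solvable.

  Let \<open>D\<close> be connected and \<open>x\<close> in \<open>D\<close>. Suppose that for every path that starts in \<open>x\<close>, stays among
  vertices of the same degree type (finite or infinite) as \<open>x\<close> and ends with one vertex \<open>w\<close> of the other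
  type, each component of the rest of \<open>D\<close> adjacent to \<open>w\<close> is hereditarily solvable. Then \<open>D\<close> splits into a
  set \<open>R\<close> of vertices of the type of \<open>x\<close> and pairwise non-adjacent solvable sets with finite boundary
  in \<open>R\<close>, and their solutions can be glued: by compactness if \<open>R\<close> has finite degrees, and by coloring
  the critical vertices of \<open>R\<close> last if it has infinite degrees. So \<open>D\<close> is hereditarily solvable.
  Consequently, an unsolvable set allows one to go on forever, which yields an alternating ray.\<close>

section \<open>Symmetric differences\<close>

lemma flip_flip: "flip (flip c F) F' = flip c (sym_diff F F')"
  by (auto simp: flip_def)

text \<open>The sets may be infinite, so their sizes cannot be subtracted directly. Inside the
  finite set \<open>U\<close> of all changes, \<open>card (X - Y) - card (Y - X)\<close> equals
  \<open>card (X \<inter> U) - card (Y \<inter> U)\<close>, and such differences telescope.\<close>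

lemma card_diff_telescope:
  assumes "finite (sym_diff A B)" "finite (sym_diff B C)"
  shows "int (card (A - C)) - int (card (C - A)) =
    (int (card (A - B)) - int (card (B - A))) + (int (card (B - C)) - int (card (C - B)))"
proof -
  define U where "U = sym_diff A B \<union> sym_diff B C"
  have fin: "finite U" using assms by (simp add: U_def)
  have *: "int (card (X - Y)) - int (card (Y - X)) = int (card (X \<inter> U)) - int (card (Y \<inter> U))"
    if "sym_diff X Y \<subseteq> U" for X Y
  proof -
    have "X \<inter> U = (X - Y) \<union> (X \<inter> Y \<inter> U)" "Y \<inter> U = (Y - X) \<union> (X \<inter> Y \<inter> U)" using that by auto
    moreover have "card ((X - Y) \<union> (X \<inter> Y \<inter> U)) = card (X - Y) + card (X \<inter> Y \<inter> U)"
      by (rule card_Un_disjoint) (use that fin in \<open>auto intro: finite_subset[OF _ fin]\<close>)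
    moreover have "card ((Y - X) \<union> (X \<inter> Y \<inter> U)) = card (Y - X) + card (X \<inter> Y \<inter> U)"
      by (rule card_Un_disjoint) (use that fin in \<open>auto intro: finite_subset[OF _ fin]\<close>)
    ultimately show ?thesis by simp
  qed
  show ?thesis
    using *[of A B] *[of B C] *[of A C] by (auto simp: U_def)
qed

subsection \<open>The gain of a recoloring\<close>

locale sym_graph =
  fixes E :: "'a \<Rightarrow> 'a \<Rightarrow> bool"
  assumes sym: "E u v \<Longrightarrow> E v u" and irrefl: "\<not> E v v"
begin

abbreviation N :: "'a \<Rightarrow> 'a set" where "N \<equiv> nbhd E"

abbreviation fd :: "'a \<Rightarrow> bool" where "fd \<equiv> finite_deg E"

lemma N_sym: "u \<in> N v \<longleftrightarrow> v \<in> N u"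
  using sym by (auto simp: nbhd_def)

lemma N_irrefl: "v \<notin> N v"
  using irrefl by (simp add: nbhd_def)

lemma finite_N: "fd v \<Longrightarrow> finite (N v)"
  by (simp add: finite_deg_def)

definition finsets :: "'a set \<Rightarrow> 'a set set" where
  "finsets A = {F. finite F \<and> F \<subseteq> A \<and> (\<forall>v\<in>F. fd v)}"

text \<open>For \<open>F\<close> in \<open>finsets A\<close> this is \<open>dtrans\<close> as a
  local sum: an edge inside \<open>F\<close> keeps its status, and an edge leaving \<open>F\<close>
  counts 1 if the flip destroys a bichromatic edge and -1 if it creates one.\<close>

definition gain :: "('a \<Rightarrow> bool) \<Rightarrow> 'a set \<Rightarrow> int" where
  "gain c F = (\<Sum>u\<in>F. \<Sum>w\<in>N u - F. if c u \<noteq> c w then 1 else - 1)"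

lemma finsetsI: "finite F \<Longrightarrow> F \<subseteq> A \<Longrightarrow> (\<And>v. v \<in> F \<Longrightarrow> fd v) \<Longrightarrow> F \<in> finsets A"
  by (auto simp: finsets_def)

lemma finsets_sym_diff: "F \<in> finsets A \<Longrightarrow> F' \<in> finsets A \<Longrightarrow> sym_diff F F' \<in> finsets A"
  by (auto simp: finsets_def)

text \<open>A bichromatic edge is destroyed exactly if one of its ends lies in \<open>F\<close>;
  orienting it out of \<open>F\<close> turns these edges into pairs that can be counted.\<close>

lemma trans_edges_diff_flip:
  "trans_edges E c - trans_edges E (flip c F) =
     (\<lambda>(u, w). {u, w}) ` (SIGMA u:F. {w \<in> N u - F. c u \<noteq> c w})" (is "?L = ?R")
proof
  show "?L \<subseteq> ?R"
  proof
    fix e assume "e \<in> ?L"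
    then obtain u w where e: "e = {u, w}" "E u w" "c u \<noteq> c w" and n: "e \<notin> trans_edges E (flip c F)"
      by (auto simp: trans_edges_def)
    have "flip c F u = flip c F w" using n e by (auto simp: trans_edges_def)
    then have "u \<in> F \<and> w \<notin> F \<or> w \<in> F \<and> u \<notin> F" using e by (auto simp: flip_def split: if_splits)
    then show "e \<in> ?R"
    proof
      assume "u \<in> F \<and> w \<notin> F"
      then have "(u, w) \<in> (SIGMA u:F. {w \<in> N u - F. c u \<noteq> c w})" using e by (auto simp: nbhd_def)
      then show ?thesis using e(1) by (auto intro!: rev_image_eqI)
    next
      assume "w \<in> F \<and> u \<notin> F"
      then have "(w, u) \<in> (SIGMA u:F. {w \<in> N u - F. c u \<noteq> c w})" using e sym by (auto simp: nbhd_def)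
      then show ?thesis using e(1) by (auto intro!: rev_image_eqI)
    qed
  qed
  show "?R \<subseteq> ?L"
    by (fastforce simp: trans_edges_def nbhd_def flip_def doubleton_eq_iff split: if_splits)
qed

lemma inj_on_edge: "inj_on (\<lambda>(u, w). {u, w}) (SIGMA u:F. {w \<in> N u - F. P u w})"
  by (auto simp: inj_on_def doubleton_eq_iff)

lemma finite_trans_edges_diff:
  assumes "F \<in> finsets A"
  shows "finite (trans_edges E c - trans_edges E (flip c F))"
  unfolding trans_edges_diff_flip using assms by (auto simp: finsets_def finite_N)

text \<open>Flipping is an involution, so the created edges are those destroyed by flipping back;
  one count serves both halves of \<open>dtrans\<close>.\<close>

lemma trans_edges_flip_diff:
  "trans_edges E (flip c F) - trans_edges E c =
    trans_edges E (flip c F) - trans_edges E (flip (flip c F) F)"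
  by (simp add: flip_flip) (simp add: flip_def)

lemma dtrans_eq_gain:
  assumes "F \<in> finsets A"
  shows "dtrans E c F = gain c F"
proof -
  have F: "finite F" "\<And>u. u \<in> F \<Longrightarrow> finite (N u)" using assms by (auto simp: finsets_def finite_N)
  have 1: "int (card (trans_edges E d - trans_edges E (flip d F))) =
      (\<Sum>u\<in>F. \<Sum>w\<in>N u - F. if d u \<noteq> d w then 1 else 0)" for d
  proof -
    have "card (trans_edges E d - trans_edges E (flip d F)) =
        card (SIGMA u:F. {w \<in> N u - F. d u \<noteq> d w})"
      unfolding trans_edges_diff_flip by (rule card_image[OF inj_on_edge])
    also have "\<dots> = (\<Sum>u\<in>F. card {w \<in> N u - F. d u \<noteq> d w})"
      by (rule card_SigmaI) (use F in auto)
    finally have "int (card (trans_edges E d - trans_edges E (flip d F))) =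
      (\<Sum>u\<in>F. int (card {w \<in> N u - F. d u \<noteq> d w}))" by simp
    also have "\<dots> = (\<Sum>u\<in>F. \<Sum>w\<in>N u - F. if d u \<noteq> d w then 1 else 0)"
    proof (rule sum.cong[OF refl])
      fix u assume "u \<in> F"
      then have "finite (N u - F)" using F by auto
      then show "int (card {w \<in> N u - F. d u \<noteq> d w}) = (\<Sum>w\<in>N u - F. if d u \<noteq> d w then 1 else 0)"
        by (simp add: sum.If_cases Int_def)
    qed
    finally show ?thesis .
  qed
  have "dtrans E c F = (\<Sum>u\<in>F. \<Sum>w\<in>N u - F. if c u \<noteq> c w then 1 else 0) -
     (\<Sum>u\<in>F. \<Sum>w\<in>N u - F. if flip c F u \<noteq> flip c F w then 1 else 0)"
    unfolding dtrans_def trans_edges_flip_diff 1 by simp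
  also have "\<dots> = gain c F"
    unfolding gain_def sum_subtractf[symmetric]
    by (intro sum.cong refl) (auto simp: flip_def)
  finally show ?thesis .
qed

lemma strongly_maximal_iff: "strongly_maximal E c A \<longleftrightarrow> (\<forall>F\<in>finsets A. gain c F \<ge> 0)"
proof -
  have "strongly_maximal E c A \<longleftrightarrow> (\<forall>F\<in>finsets A. dtrans E c F \<ge> 0)"
    by (auto simp: strongly_maximal_def finsets_def)
  then show ?thesis using dtrans_eq_gain[of _ A c] by auto
qed

text \<open>Flipping \<open>F\<close> and then \<open>F'\<close> flips their symmetric difference,
  and the net edge counts of the two stages add up.\<close>

lemma gain_sym_diff:
  assumes "F \<in> finsets A" "F' \<in> finsets A"
  shows "gain c (sym_diff F F') = gain c F + gain (flip c F) F'"
proof -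
  have fin: "finite (sym_diff (trans_edges E d) (trans_edges E (flip d G)))" if "G \<in> finsets A" for d G
    using finite_trans_edges_diff[OF that, of d] finite_trans_edges_diff[OF that, of "flip d G"]
    by (simp add: trans_edges_flip_diff)
  show ?thesis
    using card_diff_telescope[OF fin[OF assms(1), of c] fin[OF assms(2), of "flip c F"]]
    unfolding dtrans_eq_gain[OF assms(1), symmetric] dtrans_eq_gain[OF assms(2), symmetric]
      dtrans_eq_gain[OF finsets_sym_diff[OF assms], symmetric] dtrans_def flip_flip .
qed

lemma gain_cong:
  assumes "\<And>u. u \<in> F \<Longrightarrow> c u = c' u" "\<And>u w. u \<in> F \<Longrightarrow> w \<in> N u \<Longrightarrow> c w = c' w"
  shows "gain c F = gain c' F"
  unfolding gain_def using assms by (auto intro!: sum.cong)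

lemma gain_empty [simp]: "gain c {} = 0"
  by (simp add: gain_def)

text \<open>No edge joins different classes of \<open>F\<close>, so the neighbors of a vertex
  outside its class are its neighbors outside \<open>F\<close>.\<close>

lemma gain_labels:
  assumes "finite F" and lab: "\<And>u w. u \<in> F \<Longrightarrow> w \<in> F \<Longrightarrow> w \<in> N u \<Longrightarrow> lab u = lab w"
  shows "gain c F = (\<Sum>i\<in>lab ` F. gain c {u \<in> F. lab u = i})"
proof -
  have "(\<Sum>i\<in>lab ` F. gain c {u \<in> F. lab u = i}) =
     (\<Sum>i\<in>lab ` F. \<Sum>u\<in>{u \<in> F. lab u = i}. \<Sum>w\<in>N u - F. if c u \<noteq> c w then 1 else - 1)"
    unfolding gain_def
  proof (intro sum.cong refl)
    fix i u assume "u \<in> {u \<in> F. lab u = i}"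
    then show "N u - {u \<in> F. lab u = i} = N u - F" using lab by fastforce
  qed
  also have "\<dots> = gain c F"
    unfolding gain_def by (rule sum.group) (use assms in auto)
  finally show ?thesis by simp
qed

lemma gain_ge_deg:
  assumes "finite F"
  shows "gain c F \<ge> - (\<Sum>u\<in>F. int (card (N u)))"
proof -
  have "- int (card (N u)) \<le> (\<Sum>w\<in>N u - F. if c u \<noteq> c w then 1 else - 1)" for u
  proof (cases "finite (N u)")
    case True
    have "(\<Sum>w\<in>N u - F. (-1::int)) \<le> (\<Sum>w\<in>N u - F. if c u \<noteq> c w then 1 else - 1)"
      by (rule sum_mono) auto
    moreover have "card (N u - F) \<le> card (N u)" using True by (auto intro: card_mono)
    ultimately show ?thesis by simp
  next
    \<comment> \<open>Here \<open>N u - F\<close> is infinite as well, and both the sum and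
      \<open>card (N u)\<close> take the default value 0.\<close>
    case False
    then show ?thesis using assms by simp
  qed
  then have "(\<Sum>u\<in>F. - int (card (N u))) \<le> gain c F"
    unfolding gain_def by (rule sum_mono)
  then show ?thesis by (simp add: sum_negf)
qed

subsection \<open>Finite repairs\<close>

text \<open>Choose \<open>Z\<close> of minimal gain, which exists since the gains are integers
  bounded below; by additivity, a further flip of negative gain would contradict minimality.\<close>

lemma repair_bounded:
  assumes "\<And>F. F \<in> finsets A \<Longrightarrow> gain c F \<ge> - B"
  obtains Z where "Z \<in> finsets A" "strongly_maximal E (flip c Z) A"
proof -
  have "{} \<in> finsets A" by (simp add: finsets_def)
  then obtain Z where Z: "Z \<in> finsets A"
    and min: "\<And>F. F \<in> finsets A \<Longrightarrow> nat (gain c Z + B) \<le> nat (gain c F + B)"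
    using ex_has_least_nat[of "\<lambda>F. F \<in> finsets A" "{}" "\<lambda>F. nat (gain c F + B)"] by blast
  have "strongly_maximal E (flip c Z) A"
    unfolding strongly_maximal_iff
  proof
    fix F assume F: "F \<in> finsets A"
    have "gain c (sym_diff Z F) = gain c Z + gain (flip c Z) F"
      by (rule gain_sym_diff[OF Z F])
    then show "0 \<le> gain (flip c Z) F"
      using min[OF finsets_sym_diff[OF Z F]] assms[OF finsets_sym_diff[OF Z F]] assms[OF Z] by linarith
  qed
  then show thesis using Z that by blast
qed

text \<open>Split \<open>F\<close> at \<open>P\<close>: the part outside \<open>P\<close> has
  nonnegative gain, and the part inside costs at most its degree sum. So the gain is bounded
  below.\<close>

lemma repair_enlarged:
  assumes sm: "strongly_maximal E c A" and P: "finite P"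
  obtains Z where "Z \<in> finsets (A \<union> P)" "strongly_maximal E (flip c Z) (A \<union> P)"
proof (rule repair_bounded)
  fix F assume F: "F \<in> finsets (A \<union> P)"
  have 1: "F - P \<in> finsets (A \<union> P)" "F \<inter> P \<in> finsets (A \<union> P)" "F - P \<in> finsets A"
    using F by (auto simp: finsets_def)
  have "sym_diff (F - P) (F \<inter> P) = F" by auto
  then have "gain c F = gain c (F - P) + gain (flip c (F - P)) (F \<inter> P)"
    using gain_sym_diff[OF 1(1,2), of c] by simp
  moreover have "gain c (F - P) \<ge> 0" using sm 1 by (simp add: strongly_maximal_iff)
  moreover have "gain (flip c (F - P)) (F \<inter> P) \<ge> - (\<Sum>u\<in>F \<inter> P. int (card (N u)))"
    by (rule gain_ge_deg) (use P in auto)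
  moreover have "(\<Sum>u\<in>F \<inter> P. int (card (N u))) \<le> (\<Sum>u\<in>P. int (card (N u)))"
    by (rule sum_mono2) (use P in auto)
  ultimately show "gain c F \<ge> - (\<Sum>u\<in>P. int (card (N u)))" by linarith
qed (use that in blast)

text \<open>Recoloring a neighbor of the same color only helps; so only the vertices with a recolored
  neighbor of the opposite color can make the gain drop.\<close>

lemma repair_perturbed:
  assumes sm: "strongly_maximal E c A" and eq: "\<And>v. v \<in> A \<Longrightarrow> fd v \<Longrightarrow> c' v = c v"
    and fin: "finite {u \<in> A. fd u \<and> (\<exists>w\<in>N u. c w \<noteq> c u \<and> c' w \<noteq> c w)}"
  obtains Z where "Z \<in> finsets A" "strongly_maximal E (flip c' Z) A"
proof (rule repair_bounded)
  define M where "M = {u \<in> A. fd u \<and> (\<exists>w\<in>N u. c w \<noteq> c u \<and> c' w \<noteq> c w)}"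
  fix F assume F: "F \<in> finsets A"
  have fF: "finite F" using F by (simp add: finsets_def)
  \<comment> \<open>A vertex of \<open>M\<close> loses at most 2 per neighbor. At any other
    \<open>u\<close> every recolored neighbor had the color of \<open>u\<close>, so its term rises
    from -1 to 1.\<close>
  have "(\<Sum>w\<in>N u - F. if c u \<noteq> c w then 1 else - 1) - (if u \<in> M then 2 * int (card (N u)) else 0)
     \<le> (\<Sum>w\<in>N u - F. if c' u \<noteq> c' w then 1 else - 1)" if u: "u \<in> F" for u
  proof -
    have fu: "fd u" "u \<in> A" using u F by (auto simp: finsets_def)
    have fN: "finite (N u)" using fu by (simp add: finite_N)
    show ?thesis
    proof (cases "u \<in> M")
      case True
      have "(\<Sum>w\<in>N u - F. if c u \<noteq> c w then 1 else - 1) - (\<Sum>w\<in>N u - F. if c' u \<noteq> c' w then 1 else - 1)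
        \<le> (\<Sum>w\<in>N u - F. (2::int))"
        unfolding sum_subtractf[symmetric] by (rule sum_mono) auto
      also have "\<dots> \<le> 2 * int (card (N u))" using card_mono[of "N u" "N u - F"] fN by auto
      finally show ?thesis using True by simp
    next
      case False
      have "(\<Sum>w\<in>N u - F. if c u \<noteq> c w then 1 else - 1) \<le> (\<Sum>w\<in>N u - F. if c' u \<noteq> c' w then 1 else (- 1)::int)"
        by (rule sum_mono) (use False fu eq[OF fu(2,1)] in \<open>auto simp: M_def\<close>)
      then show ?thesis using False by simp
    qed
  qed
  then have "gain c F - (\<Sum>u\<in>F. if u \<in> M then 2 * int (card (N u)) else 0) \<le> gain c' F"
    unfolding gain_def sum_subtractf[symmetric] by (intro sum_mono) auto
  moreover have "(\<Sum>u\<in>F. if u \<in> M then 2 * int (card (N u)) else 0) = (\<Sum>u\<in>F \<inter> M. 2 * int (card (N u)))"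
    by (rule sum.inter_restrict[symmetric, OF fF])
  moreover have "(\<Sum>u\<in>F \<inter> M. 2 * int (card (N u))) \<le> (\<Sum>u\<in>M. 2 * int (card (N u)))"
    by (rule sum_mono2) (use fin in \<open>auto simp: M_def\<close>)
  moreover have "gain c F \<ge> 0" using sm F by (simp add: strongly_maximal_iff)
  ultimately show "gain c' F \<ge> - (\<Sum>u\<in>M. 2 * int (card (N u)))" by linarith
qed (use that in blast)

text \<open>From \<open>flip a W\<close>, a flip of \<open>F\<close> amounts to undoing
  \<open>W\<close>, which loses nothing by \<open>ge\<close>, and then flipping
  \<open>sym_diff W F\<close> in the maximal coloring \<open>a\<close>.\<close>

lemma strongly_maximal_swap:
  assumes sm: "strongly_maximal E a A" and W: "W \<in> finsets A" and ge: "gain (flip a W) W \<ge> 0"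
  shows "strongly_maximal E (flip a W) A"
  unfolding strongly_maximal_iff
proof
  fix F assume F: "F \<in> finsets A"
  have *: "flip (flip a W) W = a" by (auto simp: flip_def)
  have "gain (flip a W) (sym_diff W (sym_diff W F)) = gain (flip a W) W + gain a (sym_diff W F)"
    using gain_sym_diff[OF W finsets_sym_diff[OF W F], of "flip a W"] unfolding * .
  moreover have "sym_diff W (sym_diff W F) = F" by auto
  moreover have "gain a (sym_diff W F) \<ge> 0"
    using sm finsets_sym_diff[OF W F] by (simp add: strongly_maximal_iff)
  ultimately show "0 \<le> gain (flip a W) F" using ge by simp
qed

lemma strongly_maximal_cong:
  assumes "strongly_maximal E c A"
    and "\<And>u. u \<in> A \<Longrightarrow> fd u \<Longrightarrow> c u = c' u" "\<And>u w. u \<in> A \<Longrightarrow> fd u \<Longrightarrow> w \<in> N u \<Longrightarrow> c w = c' w"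
  shows "strongly_maximal E c' A"
  unfolding strongly_maximal_iff
proof
  fix F assume F: "F \<in> finsets A"
  have "gain c F = gain c' F"
    by (rule gain_cong) (use assms(2,3) F in \<open>auto simp: finsets_def\<close>)
  then show "0 \<le> gain c' F" using assms(1) F by (auto simp: strongly_maximal_iff)
qed

lemma strongly_maximal_labels:
  assumes lab: "\<And>u w. u \<in> A \<Longrightarrow> w \<in> A \<Longrightarrow> w \<in> N u \<Longrightarrow> lab u = lab w"
    and sm: "\<And>i. strongly_maximal E c {u \<in> A. lab u = i}"
  shows "strongly_maximal E c A"
  unfolding strongly_maximal_iff
proof
  fix F assume F: "F \<in> finsets A"
  have "gain c F = (\<Sum>i\<in>lab ` F. gain c {u \<in> F. lab u = i})"
    by (rule gain_labels) (use F lab in \<open>auto simp: finsets_def\<close>)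
  also have "\<dots> \<ge> 0"
  proof (rule sum_nonneg)
    fix i
    have "{u \<in> F. lab u = i} \<in> finsets {u \<in> A. lab u = i}" using F by (auto simp: finsets_def)
    then show "0 \<le> gain c {u \<in> F. lab u = i}" using sm[of i] by (simp add: strongly_maximal_iff)
  qed
  finally show "0 \<le> gain c F" .
qed

subsection \<open>Solvable vertex sets\<close>

text \<open>The whole outside of \<open>D\<close> is precolored, so solvability also covers vertices
  that have already been moved into \<open>K\<close>. Only vertices with infinitely many neighbors inside
  \<open>D\<close> are subject to a condition.\<close>

definition happy :: "'a set \<Rightarrow> ('a \<Rightarrow> bool) \<Rightarrow> 'a \<Rightarrow> bool" where
  "happy D c l \<longleftrightarrow> (infinite (N l \<inter> D) \<longrightarrow> infinite {u \<in> N l \<inter> D. c u \<noteq> c l})"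

definition solvable :: "'a set \<Rightarrow> bool" where
  "solvable D \<longleftrightarrow> (\<forall>k. \<exists>c. (\<forall>v. v \<notin> D \<longrightarrow> c v = k v) \<and> strongly_maximal E c D \<and> (\<forall>l\<in>D. happy D c l))"

lemma solvableE:
  assumes "solvable D"
  obtains c where "\<And>v. v \<notin> D \<Longrightarrow> c v = k v" "strongly_maximal E c D" "\<And>l. l \<in> D \<Longrightarrow> happy D c l"
  using assms unfolding solvable_def by metis

lemma happy_transfer:
  assumes h: "happy D c l" and cl: "c' l = c l"
    and inf: "infinite (N l \<inter> D') \<Longrightarrow> infinite (N l \<inter> D)"
    and fin: "finite {u \<in> N l \<inter> D. \<not> (u \<in> D' \<and> c' u = c u)}"
  shows "happy D' c' l"
  unfolding happy_def
proof
  assume "infinite (N l \<inter> D')"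
  then have "infinite {u \<in> N l \<inter> D. c u \<noteq> c l}" using h inf by (simp add: happy_def)
  moreover have "{u \<in> N l \<inter> D. c u \<noteq> c l} \<subseteq>
      {u \<in> N l \<inter> D'. c' u \<noteq> c' l} \<union> {u \<in> N l \<inter> D. \<not> (u \<in> D' \<and> c' u = c u)}"
    using cl by auto
  ultimately show "infinite {u \<in> N l \<inter> D'. c' u \<noteq> c' l}"
    using fin by (meson finite_UnI finite_subset)
qed

lemma happy_finite_change:
  assumes "happy D c l" "c' l = c l" "finite Z" "\<And>u. u \<notin> Z \<Longrightarrow> c' u = c u"
  shows "happy D c' l"
proof (rule happy_transfer[OF assms(1)])
  have "{u \<in> N l \<inter> D. \<not> (u \<in> D \<and> c' u = c u)} \<subseteq> Z" using assms(4) by blast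
  then show "finite {u \<in> N l \<inter> D. \<not> (u \<in> D \<and> c' u = c u)}" using assms(3) by (rule finite_subset)
qed (use assms(2) in auto)

lemma happy_fd: "fd l \<Longrightarrow> happy D c l"
  using finite_N by (auto simp: happy_def)

text \<open>All but finitely many neighbors of \<open>v\<close> in \<open>D\<close> share its color,
  so flipping \<open>v\<close> satisfies it. Only the finitely many others can lose by this, and
  finitely many flips of vertices of finite degree restore maximality without touching any further
  vertex of infinite degree.\<close>

lemma make_happy:
  assumes sm: "strongly_maximal E c D" and v: "v \<in> D" and un: "\<not> happy D c v"
  obtains c' Z where "finite Z" "Z \<subseteq> D" "\<And>u. u \<notin> Z \<Longrightarrow> c' u = c u" "strongly_maximal E c' D"
    "happy D c' v" "\<And>l. happy D c l \<Longrightarrow> happy D c' l"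
proof -
  have inf: "infinite (N v \<inter> D)" and fin: "finite {u \<in> N v \<inter> D. c u \<noteq> c v}"
    using un by (auto simp: happy_def)
  have nfd: "\<not> fd v" using inf finite_N by auto
  define c1 where "c1 = flip c {v}"
  have "{u \<in> D. fd u \<and> (\<exists>w\<in>N u. c w \<noteq> c u \<and> c1 w \<noteq> c w)} \<subseteq> {u \<in> N v \<inter> D. c u \<noteq> c v}"
    using N_sym by (auto simp: c1_def flip_def split: if_splits)
  then obtain Z where Z: "Z \<in> finsets D" "strongly_maximal E (flip c1 Z) D"
    using repair_perturbed[OF sm, of c1] finite_subset[OF _ fin] nfd
    by (metis (no_types, lifting) c1_def flip_def singletonD)
  let ?c = "flip c1 Z"
  have Zf: "finite Z" "Z \<subseteq> D" "\<And>u. u \<in> Z \<Longrightarrow> fd u" using Z by (auto simp: finsets_def)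
  have vZ: "v \<notin> Z" using Zf nfd by auto
  have "infinite (N v \<inter> D - ({u \<in> N v \<inter> D. c u \<noteq> c v} \<union> Z))" using inf fin Zf by simp
  moreover have "N v \<inter> D - ({u \<in> N v \<inter> D. c u \<noteq> c v} \<union> Z) \<subseteq> {u \<in> N v \<inter> D. ?c u \<noteq> ?c v}"
    using vZ N_irrefl[of v] by (auto simp: c1_def flip_def)
  ultimately have hv: "happy D ?c v" unfolding happy_def using finite_subset by blast
  have same: "?c u = c u" if "u \<notin> insert v Z" for u using that by (auto simp: c1_def flip_def)
  have "happy D ?c l" if "happy D c l" for l
  proof (cases "fd l")
    case True then show ?thesis by (rule happy_fd)
  next
    case False
    then have "l \<noteq> v \<Longrightarrow> ?c l = c l" using Zf same by blast
    then show ?thesis using hv happy_finite_change[OF that _ _ same] Zf by blast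
  qed
  then show thesis using that[of "insert v Z" ?c] Zf v Z(2) hv same by blast
qed

text \<open>Satisfying one vertex spoils no other, so the vertices of \<open>P\<close> can be
  treated one after another.\<close>

lemma make_all_happy:
  assumes "finite P" "P \<subseteq> D" "strongly_maximal E c D"
  shows "\<exists>c' Z. finite Z \<and> Z \<subseteq> D \<and> (\<forall>u. u \<notin> Z \<longrightarrow> c' u = c u) \<and> strongly_maximal E c' D \<and>
    (\<forall>l\<in>P. happy D c' l) \<and> (\<forall>l. happy D c l \<longrightarrow> happy D c' l)"
  using assms
proof (induction P rule: finite_induct)
  case empty
  then show ?case by (intro exI[of _ c] exI[of _ "{}"]) auto
next
  case (insert v P)
  then obtain c1 Z1 where 1: "finite Z1" "Z1 \<subseteq> D" "\<forall>u. u \<notin> Z1 \<longrightarrow> c1 u = c u" "strongly_maximal E c1 D"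
    "\<forall>l\<in>P. happy D c1 l" "\<forall>l. happy D c l \<longrightarrow> happy D c1 l" by auto
  show ?case
  proof (cases "happy D c1 v")
    case True
    then show ?thesis using 1 by (intro exI[of _ c1] exI[of _ Z1]) auto
  next
    case False
    obtain c2 Z2 where 2: "finite Z2" "Z2 \<subseteq> D" "\<And>u. u \<notin> Z2 \<Longrightarrow> c2 u = c1 u" "strongly_maximal E c2 D"
      "happy D c2 v" "\<And>l. happy D c1 l \<Longrightarrow> happy D c2 l"
      by (rule make_happy[OF 1(4) _ False]) (use insert.prems in blast)+
    have "\<forall>u. u \<notin> Z1 \<union> Z2 \<longrightarrow> c2 u = c u" using 1(3) 2(3) by simp
    moreover have "\<forall>l\<in>insert v P. happy D c2 l" "\<forall>l. happy D c l \<longrightarrow> happy D c2 l" using 1(5,6) 2(5,6) by auto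
    moreover have "finite (Z1 \<union> Z2)" "Z1 \<union> Z2 \<subseteq> D" using 1(1,2) 2(1,2) by auto
    ultimately show ?thesis using 2(4) by blast
  qed
qed

text \<open>Solve \<open>D - P\<close> with \<open>P\<close> colored by \<open>k\<close>, restore
  maximality on \<open>D\<close> by finitely many flips, then satisfy the vertices of
  \<open>P\<close>. The other vertices of infinite degree see only finitely many changes.\<close>

lemma solvable_finite_extension:
  assumes P: "finite P" and sol: "solvable (D - P)"
  shows "solvable D"
  unfolding solvable_def
proof
  fix k
  obtain c where c: "\<And>v. v \<notin> D - P \<Longrightarrow> c v = k v" "strongly_maximal E c (D - P)"
    "\<And>l. l \<in> D - P \<Longrightarrow> happy (D - P) c l" using solvableE[OF sol, of k] by metis
  have "finite (D \<inter> P)" "D - P \<union> D \<inter> P = D" using P by auto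
  then obtain Z where Z: "Z \<in> finsets D" "strongly_maximal E (flip c Z) D"
    using repair_enlarged[OF c(2), of "D \<inter> P"] by metis
  have Zf: "finite Z" "Z \<subseteq> D" "\<And>u. u \<in> Z \<Longrightarrow> fd u" using Z by (auto simp: finsets_def)
  obtain c' Z' where c': "finite Z'" "Z' \<subseteq> D" "\<And>u. u \<notin> Z' \<Longrightarrow> c' u = flip c Z u" "strongly_maximal E c' D"
    "\<And>l. l \<in> D \<inter> P \<Longrightarrow> happy D c' l" "\<And>l. happy D (flip c Z) l \<Longrightarrow> happy D c' l"
    using make_all_happy[OF \<open>finite (D \<inter> P)\<close> _ Z(2)] by (metis inf_le1)
  have "happy D (flip c Z) l" if l: "l \<in> D - P" for l
  proof (cases "fd l")
    case True then show ?thesis by (rule happy_fd)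
  next
    case False
    then have "l \<notin> Z" using Zf by auto
    show ?thesis
    proof (rule happy_transfer[OF c(3)[OF l]])
      show "flip c Z l = c l" using \<open>l \<notin> Z\<close> by (simp add: flip_def)
      assume "infinite (N l \<inter> D)"
      then have "infinite (N l \<inter> D - P)" using P by simp
      then show "infinite (N l \<inter> (D - P))" by (simp add: Int_Diff)
    next
      have "{u \<in> N l \<inter> (D - P). \<not> (u \<in> D \<and> flip c Z u = c u)} \<subseteq> Z" by (auto simp: flip_def)
      then show "finite {u \<in> N l \<inter> (D - P). \<not> (u \<in> D \<and> flip c Z u = c u)}"
        using Zf(1) by (rule finite_subset)
    qed
  qed
  then have "\<forall>l\<in>D. happy D c' l" using c'(5,6) by blast
  moreover have "c' v = k v" if "v \<notin> D" for v
  proof -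
    have "v \<notin> Z'" "v \<notin> Z" using that c'(2) Zf(2) by auto
    then show ?thesis using c'(3)[of v] c(1)[of v] that by (simp add: flip_def)
  qed
  ultimately show "\<exists>c. (\<forall>v. v \<notin> D \<longrightarrow> c v = k v) \<and> strongly_maximal E c D \<and> (\<forall>l\<in>D. happy D c l)"
    using c'(4) by blast
qed

text \<open>By \<open>closed\<close>, no vertex of \<open>A\<close> has a neighbor in
  \<open>B - A\<close>, so recoloring \<open>B - A\<close> by \<open>k\<close> goes unnoticed in
  \<open>A\<close>.\<close>

lemma solvable_subset:
  assumes sol: "solvable B" and sub: "A \<subseteq> B"
    and closed: "\<And>u w. u \<in> A \<Longrightarrow> w \<in> N u \<Longrightarrow> w \<in> B \<Longrightarrow> w \<in> A"
  shows "solvable A"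
  unfolding solvable_def
proof
  fix k
  obtain c where c: "\<And>v. v \<notin> B \<Longrightarrow> c v = k v" "strongly_maximal E c B" "\<And>l. l \<in> B \<Longrightarrow> happy B c l"
    using solvableE[OF sol, of k] by metis
  define c' where "c' = (\<lambda>v. if v \<in> A then c v else k v)"
  have eq: "c w = c' w" if "u \<in> A" "w \<in> N u" for u w
    using closed[OF that] c(1)[of w] by (auto simp: c'_def)
  have "strongly_maximal E c A" using c(2) sub by (auto simp: strongly_maximal_def)
  then have "strongly_maximal E c' A"
    by (rule strongly_maximal_cong) (use eq in \<open>auto simp: c'_def\<close>)
  moreover have "happy A c' l" if l: "l \<in> A" for l
  proof (rule happy_transfer[OF c(3)])
    show "infinite (N l \<inter> A) \<Longrightarrow> infinite (N l \<inter> B)"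
      using sub by (meson Int_mono finite_subset order_refl)
    have "{u \<in> N l \<inter> B. \<not> (u \<in> A \<and> c' u = c u)} = {}" using closed[OF l] by (auto simp: c'_def)
    then show "finite {u \<in> N l \<inter> B. \<not> (u \<in> A \<and> c' u = c u)}" by (simp only: finite.emptyI)
  qed (use l sub in \<open>auto simp: c'_def\<close>)
  ultimately show "\<exists>c. (\<forall>v. v \<notin> A \<longrightarrow> c v = k v) \<and> strongly_maximal E c A \<and> (\<forall>l\<in>A. happy A c l)"
    by (intro exI[of _ c']) (auto simp: c'_def)
qed

lemma solvable_empty: "solvable {}"
  by (auto simp: solvable_def strongly_maximal_iff finsets_def)

end

section \<open>Gluing over vertices of finite degree\<close>

text \<open>Koenig's argument: along an enumeration of \<open>R\<close>, fix one value after
  another, always keeping infinitely many \<open>n\<close>.\<close>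

lemma bool_compactness:
  fixes f :: "nat \<Rightarrow> 'b \<Rightarrow> bool"
  assumes "countable R"
  shows "\<exists>y. \<forall>T. finite T \<longrightarrow> T \<subseteq> R \<longrightarrow> infinite {n. \<forall>t\<in>T. f n t = y t}"
proof -
  define e where "e = from_nat_into R"
  define P where "P = (\<lambda>m g. infinite {n. \<forall>i<m. f n (e i) = g i})"
  have "\<exists>g'. P (Suc m) g' \<and> (\<forall>i<m. g' i = g i)" if "P m g" for m and g :: "nat \<Rightarrow> bool"
  proof -
    let ?I = "\<lambda>b. {n. \<forall>i<Suc m. f n (e i) = (g(m := b)) i}"
    have "{n. \<forall>i<m. f n (e i) = g i} = ?I True \<union> ?I False"
      by (auto simp: less_Suc_eq)
    then have "infinite (?I True) \<or> infinite (?I False)" using that unfolding P_def by (auto simp del: fun_upd_apply)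
    then obtain b where "infinite (?I b)" by (elim disjE) (rule that)+
    then show ?thesis unfolding P_def by (intro exI[of _ "g(m := b)"]) auto
  qed
  then have step: "\<And>g m. P m g \<Longrightarrow> \<exists>g'. P (Suc m) g' \<and> (\<forall>i<m. g' i = g i)" by blast
  have base: "\<exists>g. P 0 g" by (simp add: P_def)
  obtain G where G: "\<And>m. P m (G m)" "\<And>m. \<forall>i<m. G (Suc m) i = G m i"
    using dependent_nat_choice[of P "\<lambda>m g g'. \<forall>i<m. g' i = g i", OF base step] by blast
  have G_mono: "G m i = G (Suc i) i" if "i < m" for i m
    using that by (induction m) (auto simp: G(2) less_Suc_eq)
  \<comment> \<open>Entry \<open>i\<close> is settled from stage \<open>Suc i\<close> on, so the
    diagonal agrees with every later \<open>G m\<close>.\<close>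
  define y where "y = (\<lambda>t. G (Suc (to_nat_on R t)) (to_nat_on R t))"
  have "infinite {n. \<forall>t\<in>T. f n t = y t}" if T: "finite T" "T \<subseteq> R" for T
  proof -
    obtain m where m: "\<And>t. t \<in> T \<Longrightarrow> to_nat_on R t < m"
      using finite_nat_set_iff_bounded[of "to_nat_on R ` T"] T(1) by auto
    have "{n. \<forall>i<m. f n (e i) = G m i} \<subseteq> {n. \<forall>t\<in>T. f n t = y t}"
    proof
      fix n assume n: "n \<in> {n. \<forall>i<m. f n (e i) = G m i}"
      have "f n t = y t" if "t \<in> T" for t
      proof -
        have "e (to_nat_on R t) = t" using that T assms by (auto simp: e_def)
        then show ?thesis using n m[OF that] G_mono[OF m[OF that]] by (auto simp: y_def)
      qed
      then show "n \<in> {n. \<forall>t\<in>T. f n t = y t}" by blast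
    qed
    then show ?thesis using G(1)[of m] unfolding P_def using finite_subset by blast
  qed
  then show ?thesis by blast
qed

context sym_graph
begin

text \<open>Compactness over \<open>R\<close>: each label class is repaired by finitely many flips once the coloring of
  its finite boundary in \<open>R\<close> is known, so a limit of the colorings that are maximal on \<open>D - R\<close> and
  finitely many vertices of \<open>R\<close> determines a coloring of \<open>D\<close>.\<close>

lemma solvable_glue_fd:
  assumes R: "R \<subseteq> D" "countable R" "\<And>r. r \<in> R \<Longrightarrow> fd r"
    and lab: "\<And>u w. u \<in> D - R \<Longrightarrow> w \<in> D - R \<Longrightarrow> w \<in> N u \<Longrightarrow> lab u = lab w"
    and fin: "\<And>i. finite {r \<in> R. \<exists>u\<in>D - R. lab u = i \<and> r \<in> N u}"
    and sol: "\<And>i. solvable {u \<in> D - R. lab u = i}"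
  shows "solvable D"
  unfolding solvable_def
proof
  fix k
  define A where "A = (\<lambda>i. {u \<in> D - R. lab u = i})"
  define NA where "NA = (\<lambda>i. {r \<in> R. \<exists>u\<in>D - R. lab u = i \<and> r \<in> N u})"
  have NA: "finite (NA i)" "NA i \<subseteq> R" for i using fin by (auto simp: NA_def)
  have NA_closed: "w \<in> A i \<union> NA i \<or> w \<notin> D" if "u \<in> A i" "w \<in> N u" for u w i
    using that lab[of u w] by (auto simp: A_def NA_def)
  have "\<exists>c. (\<forall>v. v \<notin> A i \<longrightarrow> c v = k v) \<and> strongly_maximal E c (A i) \<and> (\<forall>l\<in>A i. happy (A i) c l)" for i
    using sol[of i] by (simp add: solvable_def A_def)
  then obtain s where s: "\<And>i v. v \<notin> A i \<Longrightarrow> s i v = k v" "\<And>i. strongly_maximal E (s i) (A i)"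
    "\<And>i l. l \<in> A i \<Longrightarrow> happy (A i) (s i) l" by metis
  \<comment> \<open>Each \<open>s i\<close> equals \<open>k\<close> outside its class, in particular
    on \<open>R\<close>, and no edge joins two classes; so the class solutions fit together.\<close>
  define c0 where "c0 = (\<lambda>v. if v \<in> D - R then s (lab v) v else k v)"
  have c0_k: "c0 v = k v" if "v \<notin> D - R" for v using that by (auto simp: c0_def)
  have c0_A: "c0 v = s i v" if "v \<in> A i" for v i using that by (auto simp: c0_def A_def)
  have c0_sm: "strongly_maximal E c0 (A i)" for i
  proof (rule strongly_maximal_cong[OF s(2)[of i]])
    fix u assume u: "u \<in> A i"
    show "s i u = c0 u" using c0_A[OF u] by simp
    fix w assume w: "w \<in> N u"
    show "s i w = c0 w"
      using NA_closed[OF u w] c0_A[of w i] c0_k[of w] NA(2)[of i] s(1)[of w i] by (cases "w \<in> A i") auto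
  qed
  have c0_smU: "strongly_maximal E c0 (D - R)"
    by (rule strongly_maximal_labels[where lab = lab]) (use lab c0_sm in \<open>auto simp: A_def\<close>)
  \<comment> \<open>The sets \<open>X n\<close> are finite and exhaust \<open>R\<close>. The
    coloring \<open>a n\<close> will be maximal on \<open>D - R \<union> X n\<close>, and
    \<open>y\<close> is a limit of the \<open>a n\<close> on \<open>R\<close>.\<close>
  define X where "X = (\<lambda>n. {r \<in> R. to_nat_on R r \<le> n})"
  have finX: "finite (X n)" for n
    by (rule finite_imageD[of "to_nat_on R"], rule finite_subset[of _ "{..n}"])
      (auto simp: X_def intro: inj_on_subset[OF inj_on_to_nat_on[OF R(2)]])
  have "\<exists>Z\<in>finsets (D - R \<union> X n). strongly_maximal E (flip c0 Z) (D - R \<union> X n)" for n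
    using repair_enlarged[OF c0_smU finX[of n]] by metis
  then obtain Z where Z: "\<And>n. Z n \<in> finsets (D - R \<union> X n)"
    "\<And>n. strongly_maximal E (flip c0 (Z n)) (D - R \<union> X n)" by metis
  define a where "a = (\<lambda>n. flip c0 (Z n))"
  obtain y where y: "\<And>T. finite T \<Longrightarrow> T \<subseteq> R \<Longrightarrow> infinite {n. \<forall>t\<in>T. a n t = y t}"
    using bool_compactness[OF R(2), of a] by blast
  define cY where "cY = (\<lambda>v. if v \<in> R then y v else c0 v)"
  \<comment> \<open>Passing from \<open>k\<close> to \<open>y\<close> on \<open>R\<close> affects
    only neighbors of \<open>NA i\<close> in class \<open>i\<close>. These are finitely many, as
    \<open>NA i\<close> is finite and its vertices have finite degree.\<close>
  have "\<exists>M\<in>finsets (A i). strongly_maximal E (flip cY M) (A i)" for i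
  proof (rule repair_perturbed[OF c0_sm[of i], of cY])
    show "cY v = c0 v" if "v \<in> A i" for v using that by (auto simp: cY_def A_def)
    have "{u \<in> A i. fd u \<and> (\<exists>w\<in>N u. c0 w \<noteq> c0 u \<and> cY w \<noteq> c0 w)} \<subseteq> (\<Union>w\<in>NA i. N w)"
      using N_sym by (auto simp: cY_def NA_def A_def split: if_splits)
    moreover have "finite (\<Union>w\<in>NA i. N w)" using NA R(3) finite_N by blast
    ultimately show "finite {u \<in> A i. fd u \<and> (\<exists>w\<in>N u. c0 w \<noteq> c0 u \<and> cY w \<noteq> c0 w)}"
      by (rule finite_subset)
  qed blast
  then obtain M where M: "\<And>i. M i \<in> finsets (A i)" "\<And>i. strongly_maximal E (flip cY (M i)) (A i)" by metis
  define c where "c = flip cY (\<Union>i. M i)"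
  have MA: "M i \<subseteq> A i" "finite (M i)" "\<And>v. v \<in> M i \<Longrightarrow> fd v" for i using M(1)[of i] by (auto simp: finsets_def)
  have M_iff: "v \<in> (\<Union>i. M i) \<longleftrightarrow> v \<in> M i" if "v \<in> A i" for v i
    using that MA(1) by (fastforce simp: A_def)
  have c_A: "c v = flip cY (M i) v" if "v \<in> A i" for v i using M_iff[OF that] by (simp add: c_def flip_def)
  have c_notA: "c v = cY v" if "v \<notin> D - R" for v
  proof -
    have "v \<notin> (\<Union>i. M i)" using that MA(1) by (auto simp: A_def)
    then show ?thesis by (simp add: c_def flip_def)
  qed
  have c_R: "c r = y r" if "r \<in> R" for r using that c_notA[of r] by (simp add: cY_def)
  have c_out: "c v = k v" if "v \<notin> D" for v using that c_notA[of v] R(1) by (auto simp: cY_def c0_def)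
  have c_smA: "strongly_maximal E c (A i)" for i
  proof (rule strongly_maximal_cong[OF M(2)[of i]])
    fix u assume u: "u \<in> A i"
    show "flip cY (M i) u = c u" using c_A[OF u] by simp
    fix w assume w: "w \<in> N u"
    show "flip cY (M i) w = c w"
    proof (cases "w \<in> A i")
      case True then show ?thesis using c_A by simp
    next
      case False
      then have "w \<notin> D - R" using NA_closed[OF u w] NA(2) by auto
      then show ?thesis using c_notA[of w] False MA(1)[of i] by (auto simp: flip_def)
    qed
  qed
  have sm: "strongly_maximal E c D"
    unfolding strongly_maximal_iff
  proof
    fix F assume F: "F \<in> finsets D"
    \<comment> \<open>The gain of \<open>F\<close> depends only on \<open>NF\<close>;
      \<open>I\<close> lists the labels met by \<open>NF\<close>, and \<open>T\<close> is the finite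
      part of \<open>R\<close> that matters for these classes and for \<open>NF\<close>.\<close>
    define NF where "NF = F \<union> (\<Union>u\<in>F. N u)"
    have finNF: "finite NF" using F finite_N by (auto simp: NF_def finsets_def)
    define I where "I = lab ` (NF \<inter> (D - R))"
    define T where "T = (NF \<inter> R) \<union> (\<Union>i\<in>I. NA i)"
    have finI: "finite I" using finNF by (simp add: I_def)
    have finT: "finite T" "T \<subseteq> R" using finNF finI NA by (auto simp: T_def)
    obtain m where m: "F \<inter> R \<subseteq> X m"
    proof -
      have "finite (to_nat_on R ` (F \<inter> R))" using F by (auto simp: finsets_def)
      then obtain m where "\<And>t. t \<in> F \<inter> R \<Longrightarrow> to_nat_on R t < m"
        using finite_nat_set_iff_bounded by auto
      then show thesis using that[of m] by (fastforce simp: X_def)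
    qed
    obtain n where n: "n \<ge> m" "\<forall>t\<in>T. a n t = y t"
      using y[OF finT] unfolding infinite_nat_iff_unbounded_le by blast
    have FX: "F \<in> finsets (D - R \<union> X n)"
      using F m n(1) by (fastforce simp: finsets_def X_def)
    \<comment> \<open>On the classes with labels in \<open>I\<close>, both \<open>a n\<close> and
      \<open>c\<close> arise from \<open>c0\<close> by finitely many flips, so \<open>W\<close> is
      finite. Flipping it turns \<open>a n\<close> into a coloring \<open>b\<close> that agrees with
      \<open>c\<close> on \<open>NF\<close>.\<close>
    define W where "W = {v. v \<in> D - R \<and> lab v \<in> I \<and> a n v \<noteq> c v}"
    have Wsub: "W \<subseteq> Z n \<union> (\<Union>i\<in>I. M i)"
    proof
      fix v assume v: "v \<in> W"
      then have "v \<in> A (lab v)" by (auto simp: W_def A_def)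
      then have "c v = flip cY (M (lab v)) v" by (rule c_A)
      then show "v \<in> Z n \<union> (\<Union>i\<in>I. M i)"
        using v by (auto simp: W_def a_def flip_def cY_def split: if_splits)
    qed
    have W: "W \<in> finsets (D - R \<union> X n)"
    proof (rule finsetsI)
      show "finite W" using finite_subset[OF Wsub] finI MA(2) Z(1)[of n] by (auto simp: finsets_def)
      show "fd v" if "v \<in> W" for v using that Wsub MA(3) Z(1)[of n] by (auto simp: finsets_def)
    qed (auto simp: W_def)
    define b where "b = flip (a n) W"
    have b_A: "b v = c v" if "v \<in> A i" "i \<in> I" for v i
      using that by (auto simp: b_def W_def flip_def A_def)
    have b_T: "b v = c v" if "v \<in> T" for v
    proof -
      have "v \<in> R" "v \<notin> W" using that finT(2) by (auto simp: W_def)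
      then show ?thesis using n(2) that c_R[of v] by (simp add: b_def flip_def)
    qed
    have b_out: "b v = c v" if "v \<notin> D" for v
    proof -
      have "v \<notin> W" "v \<notin> Z n" using that Z(1)[of n] R(1) by (auto simp: W_def finsets_def X_def)
      then show ?thesis using c_out[OF that] c0_k[of v] that by (simp add: b_def a_def flip_def)
    qed
    have b_smA: "strongly_maximal E b (A i)" if i: "i \<in> I" for i
    proof (rule strongly_maximal_cong[OF c_smA[of i]])
      fix u assume u: "u \<in> A i"
      show "c u = b u" using b_A[OF u i] by simp
      fix w assume "w \<in> N u"
      then show "c w = b w" using NA_closed[OF u] b_A[of w, OF _ i] b_T[of w] b_out[of w] i
        by (fastforce simp: T_def)
    qed
    \<comment> \<open>Around these classes \<open>b\<close> agrees with \<open>c\<close> and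
      inherits its maximality. Hence passing from \<open>a n\<close> to \<open>b\<close> keeps
      maximality on \<open>D - R \<union> X n\<close>.\<close>
    have "strongly_maximal E b W"
    proof (rule strongly_maximal_labels[where lab = lab])
      show "strongly_maximal E b {u \<in> W. lab u = i}" for i
      proof (cases "i \<in> I")
        case True
        then show ?thesis using b_smA[OF True] by (auto simp: strongly_maximal_def W_def A_def)
      next
        case False
        then have "{u \<in> W. lab u = i} = {}" by (auto simp: W_def)
        then show ?thesis by (simp only:) (auto simp: strongly_maximal_iff finsets_def)
      qed
    qed (use lab in \<open>auto simp: W_def\<close>)
    then have "gain b W \<ge> 0" using W by (auto simp: strongly_maximal_iff finsets_def)
    then have "strongly_maximal E b (D - R \<union> X n)"
      using strongly_maximal_swap[OF Z(2)[of n], of W] W by (simp add: b_def a_def)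
    then have "gain b F \<ge> 0" using FX by (simp add: strongly_maximal_iff)
    moreover have bNF: "b v = c v" if "v \<in> NF" for v
      using that b_out[of v] b_T[of v] b_A[of v "lab v"] by (fastforce simp: T_def I_def A_def)
    have "gain b F = gain c F"
      by (rule gain_cong) (use bNF in \<open>auto simp: NF_def\<close>)
    ultimately show "0 \<le> gain c F" by simp
  qed
  have "happy D c l" if l: "l \<in> D" for l
  proof (cases "fd l")
    case True then show ?thesis by (rule happy_fd)
  next
    case False
    then have lA: "l \<in> A (lab l)" using l R(3) by (auto simp: A_def)
    \<comment> \<open>All but finitely many neighbors of \<open>l\<close> in \<open>D\<close> lie in
      its own class, where \<open>c\<close> differs from the class solution only on the finite set
      \<open>M (lab l)\<close>.\<close>
    have sub: "N l \<inter> D \<subseteq> (N l \<inter> A (lab l)) \<union> NA (lab l)" using NA_closed[OF lA] by blast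
    show ?thesis
    proof (rule happy_transfer[OF s(3)[OF lA]])
      have "l \<notin> M (lab l)" "l \<notin> R" using False MA(3) lA by (auto simp: A_def)
      then show "c l = s (lab l) l" using c_A[OF lA] c0_A[OF lA] by (simp add: flip_def cY_def)
      show "infinite (N l \<inter> D) \<Longrightarrow> infinite (N l \<inter> A (lab l))"
        using sub NA(1) by (meson finite_Un finite_subset)
      have "{u \<in> N l \<inter> A (lab l). \<not> (u \<in> D \<and> c u = s (lab l) u)} \<subseteq> M (lab l)"
        using c_A c0_A by (fastforce simp: flip_def cY_def A_def)
      then show "finite {u \<in> N l \<inter> A (lab l). \<not> (u \<in> D \<and> c u = s (lab l) u)}"
        using MA(2) finite_subset by blast
    qed
  qed
  then show "\<exists>c. (\<forall>v. v \<notin> D \<longrightarrow> c v = k v) \<and> strongly_maximal E c D \<and> (\<forall>l\<in>D. happy D c l)"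
    using sm c_out by blast
qed

lemma solvable_labels:
  assumes "\<And>u w. u \<in> D \<Longrightarrow> w \<in> D \<Longrightarrow> w \<in> N u \<Longrightarrow> lab u = lab w"
    and "\<And>i. solvable {u \<in> D. lab u = i}"
  shows "solvable D"
  by (rule solvable_glue_fd[where R = "{}" and lab = lab]) (use assms in auto)

end

section \<open>Gluing over vertices of infinite degree\<close>

text \<open>Visit every index infinitely often, pick a fresh element of its set at each visit, and
  color the picks by the parity of the visit number, which is the second component of the decoded
  pair.\<close>

lemma split_infinite_sets:
  assumes I: "countable I" and inf: "\<And>i. i \<in> I \<Longrightarrow> infinite (A i)"
  shows "\<exists>g. \<forall>i\<in>I. \<forall>b. infinite {x \<in> A i. g x = (b::bool)}"
proof (cases "I = {}")
  case False
  define e where "e = (\<lambda>n. from_nat_into I (fst (prod_decode n)))"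
  have eI: "e n \<in> I" for n using False by (simp add: e_def from_nat_into)
  have "\<exists>f. \<forall>n::nat. f n \<in> A (e n) - f ` {..<n}"
  proof (rule dependent_wellorder_choice)
    show "\<exists>r. r \<in> A (e n) - f ` {..<n}" for n f
    proof -
      have "infinite (A (e n) - f ` {..<n})" using inf[OF eI] by simp
      then show ?thesis using infinite_imp_nonempty by blast
    qed
    show "(r \<in> A (e n) - f ` {..<n}) = (r \<in> A (e n) - g ` {..<n})"
      if "\<And>m. m < n \<Longrightarrow> f m = g m" for r f g n
      using that by (auto simp: image_iff)
  qed
  then obtain f where f: "\<And>n. f n \<in> A (e n)" "\<And>n m. m < n \<Longrightarrow> f m \<noteq> f n" by (metis DiffD1 DiffD2 imageI lessThan_iff)
  have inj: "inj f" using f(2) by (metis injI linorder_neqE_nat)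
  define g where "g = (\<lambda>x. even (snd (prod_decode (inv f x))))"
  have "infinite {x \<in> A i. g x = b}" if i: "i \<in> I" for i b
  proof -
    define h where "h = (\<lambda>k. f (prod_encode (to_nat_on I i, if b then 2 * k else Suc (2 * k))))"
    have "inj h"
      by (rule injI) (auto simp: h_def dest!: injD[OF inj] split: if_splits)
    moreover have "range h \<subseteq> {x \<in> A i. g x = b}"
    proof (intro image_subsetI CollectI conjI)
      fix k
      have "e (prod_encode (to_nat_on I i, m)) = i" for m using i I by (simp add: e_def)
      then show "h k \<in> A i" unfolding h_def using f(1) by metis
      show "g (h k) = b" by (simp add: g_def h_def inv_f_f[OF inj])
    qed
    ultimately show ?thesis using infinite_super range_inj_infinite by blast
  qed
  then show ?thesis by blast
qed auto

text \<open>A maximal partial coloring that satisfies all its colored vertices leaves a set in which every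
  vertex has infinitely many neighbors; that set is colored by splitting all neighborhoods.\<close>

lemma infinitely_many_opposite:
  fixes Nb :: "'b \<Rightarrow> 'b set"
  assumes T: "countable T" and disj: "T \<inter> X = {}" and inf: "\<And>t. t \<in> T \<Longrightarrow> infinite (Nb t \<inter> (T \<union> X))"
  shows "\<exists>f. (\<forall>v. v \<notin> T \<longrightarrow> f v = (c v :: bool)) \<and> (\<forall>t\<in>T. infinite {u \<in> Nb t \<inter> (T \<union> X). f u \<noteq> f t})"
proof -
  define base where "base = (\<lambda>u. (u, c u)) ` X"
  \<comment> \<open>Partial colorings of \<open>T\<close>, as relations, in which every colored
    vertex already has infinitely many opposite neighbors among the colored vertices and
    \<open>X\<close>. Unions of chains keep this property, so Zorn's lemma applies.\<close>
  define \<P> where "\<P> = {g. g \<subseteq> T \<times> UNIV \<and> single_valued g \<and>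
    (\<forall>t b. (t, b) \<in> g \<longrightarrow> infinite {u \<in> Nb t. (u, \<not> b) \<in> g \<union> base})}"
  have "\<exists>M\<in>\<P>. \<forall>g\<in>\<P>. M \<subseteq> g \<longrightarrow> g = M"
  proof (rule subset_Zorn')
    fix \<C> assume ch: "subset.chain \<P> \<C>"
    then have sub: "\<C> \<subseteq> \<P>" and tot: "\<And>g h. g \<in> \<C> \<Longrightarrow> h \<in> \<C> \<Longrightarrow> g \<subseteq> h \<or> h \<subseteq> g"
      by (auto simp: subset.chain_def)
    have "single_valued (\<Union>\<C>)"
    proof (rule single_valuedI)
      fix x y z assume "(x, y) \<in> \<Union>\<C>" "(x, z) \<in> \<Union>\<C>"
      then obtain g h where "g \<in> \<C>" "h \<in> \<C>" "(x, y) \<in> g" "(x, z) \<in> h" by blast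
      then show "y = z" using tot[of g h] sub by (auto simp: \<P>_def dest: single_valuedD)
    qed
    moreover have "\<Union>\<C> \<subseteq> T \<times> UNIV" using sub by (auto simp: \<P>_def)
    moreover have "infinite {u \<in> Nb t. (u, \<not> b) \<in> \<Union>\<C> \<union> base}" if tb: "(t, b) \<in> \<Union>\<C>" for t b
    proof -
      obtain g where g: "g \<in> \<C>" "(t, b) \<in> g" using tb by blast
      then have "infinite {u \<in> Nb t. (u, \<not> b) \<in> g \<union> base}" using sub by (auto simp: \<P>_def)
      moreover have "{u \<in> Nb t. (u, \<not> b) \<in> g \<union> base} \<subseteq> {u \<in> Nb t. (u, \<not> b) \<in> \<Union>\<C> \<union> base}"
        using g by blast
      ultimately show ?thesis by (rule infinite_super[rotated])
    qed
    ultimately show "\<Union>\<C> \<in> \<P>" by (simp add: \<P>_def)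
  qed
  then obtain M where M: "M \<in> \<P>" "\<And>g. g \<in> \<P> \<Longrightarrow> M \<subseteq> g \<Longrightarrow> g = M" by blast
  have MT: "M \<subseteq> T \<times> UNIV" and sv: "single_valued M"
    and Minf: "\<And>t b. (t, b) \<in> M \<Longrightarrow> infinite {u \<in> Nb t. (u, \<not> b) \<in> M \<union> base}"
    using M(1) by (auto simp: \<P>_def)
  define Q where "Q = T - Domain M"
  \<comment> \<open>Otherwise \<open>t\<close> has infinitely many neighbors in
    \<open>Domain M\<close> or \<open>X\<close>, infinitely many of them of one color; giving
    \<open>t\<close> the other color would extend the maximal \<open>M\<close>.\<close>
  have Qinf: "infinite (Nb t \<inter> Q)" if t: "t \<in> Q" for t
  proof
    assume "finite (Nb t \<inter> Q)"
    moreover have "Nb t \<inter> (T \<union> X) \<subseteq> (Nb t \<inter> Q) \<union>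
        ({u \<in> Nb t. (u, True) \<in> M \<union> base} \<union> {u \<in> Nb t. (u, False) \<in> M \<union> base})"
    proof
      fix u assume u: "u \<in> Nb t \<inter> (T \<union> X)"
      then consider "u \<in> X" | "u \<in> Q" | b where "(u, b) \<in> M" by (auto simp: Q_def)
      then show "u \<in> (Nb t \<inter> Q) \<union>
        ({u \<in> Nb t. (u, True) \<in> M \<union> base} \<union> {u \<in> Nb t. (u, False) \<in> M \<union> base})"
      proof cases
        case 1 then show ?thesis using u by (cases "c u") (auto simp: base_def image_iff)
      next
        case 2 then show ?thesis using u by auto
      next
        case 3 then show ?thesis using u by (cases b) auto
      qed
    qed
    moreover have "infinite (Nb t \<inter> (T \<union> X))" using inf t by (simp add: Q_def)
    ultimately have "infinite {u \<in> Nb t. (u, True) \<in> M \<union> base} \<or> infinite {u \<in> Nb t. (u, False) \<in> M \<union> base}"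
      by (meson finite_UnI finite_subset)
    then obtain b where b: "infinite {u \<in> Nb t. (u, \<not> b) \<in> M \<union> base}"
    proof (elim disjE)
      assume "infinite {u \<in> Nb t. (u, True) \<in> M \<union> base}"
      then show thesis using that[of False] by simp
    next
      assume "infinite {u \<in> Nb t. (u, False) \<in> M \<union> base}"
      then show thesis using that[of True] by simp
    qed
    have "insert (t, b) M \<in> \<P>"
    proof -
      have "insert (t, b) M \<subseteq> T \<times> UNIV" using MT t by (auto simp: Q_def)
      moreover have "single_valued (insert (t, b) M)"
        using sv t by (auto simp: single_valued_def Q_def)
      moreover have "infinite {u \<in> Nb s. (u, \<not> d) \<in> insert (t, b) M \<union> base}" if "(s, d) \<in> insert (t, b) M" for s d
      proof -
        have "infinite {u \<in> Nb s. (u, \<not> d) \<in> M \<union> base}" using that b Minf by auto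
        moreover have "{u \<in> Nb s. (u, \<not> d) \<in> M \<union> base} \<subseteq> {u \<in> Nb s. (u, \<not> d) \<in> insert (t, b) M \<union> base}"
          by blast
        ultimately show ?thesis by (rule infinite_super[rotated])
      qed
      ultimately show ?thesis by (simp add: \<P>_def)
    qed
    then have "(t, b) \<in> M" using M(2)[of "insert (t, b) M"] by blast
    then show False using t by (auto simp: Q_def)
  qed
  have "countable Q" using T by (simp add: Q_def)
  then obtain g where g: "\<And>t b. t \<in> Q \<Longrightarrow> infinite {u \<in> Nb t \<inter> Q. g u = (b::bool)}"
    using split_infinite_sets[of Q "\<lambda>t. Nb t \<inter> Q"] Qinf by auto
  define f where "f = (\<lambda>v. if v \<in> Domain M then (THE b. (v, b) \<in> M) else if v \<in> T then g v else c v)"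
  have f_M: "f v = b" if "(v, b) \<in> M" for v b
  proof -
    have "(THE b. (v, b) \<in> M) = b"
    proof (rule the_equality)
      show "b' = b" if "(v, b') \<in> M" for b' using single_valuedD[OF sv that \<open>(v, b) \<in> M\<close>] .
    qed (rule that)
    then show ?thesis using that by (auto simp: f_def)
  qed
  have f_base: "f v = b" "v \<in> X" if "(v, b) \<in> base" for v b
    using that disj MT by (auto simp: f_def base_def)
  have f_Q: "f v = g v" if "v \<in> Q" for v using that by (auto simp: f_def Q_def)
  have "infinite {u \<in> Nb t \<inter> (T \<union> X). f u \<noteq> f t}" if t: "t \<in> T" for t
  proof (cases "t \<in> Q")
    case True
    have "{u \<in> Nb t \<inter> Q. g u = (\<not> g t)} \<subseteq> {u \<in> Nb t \<inter> (T \<union> X). f u \<noteq> f t}"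
      using f_Q True by (auto simp: Q_def)
    then show ?thesis using g[OF True] by (rule infinite_super)
  next
    case False
    then obtain b where b: "(t, b) \<in> M" using t by (auto simp: Q_def)
    have "{u \<in> Nb t. (u, \<not> b) \<in> M \<union> base} \<subseteq> {u \<in> Nb t \<inter> (T \<union> X). f u \<noteq> f t}"
    proof
      fix u assume "u \<in> {u \<in> Nb t. (u, \<not> b) \<in> M \<union> base}"
      then have u: "u \<in> Nb t" "(u, \<not> b) \<in> M \<or> (u, \<not> b) \<in> base" by auto
      then have "f u = (\<not> b)" "u \<in> T \<union> X" using f_M[of u "\<not> b"] f_base[of u "\<not> b"] MT by auto
      then show "u \<in> {u \<in> Nb t \<inter> (T \<union> X). f u \<noteq> f t}" using u(1) f_M[OF b] by simp
    qed
    then show ?thesis using Minf[OF b] by (rule infinite_super)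
  qed
  moreover have "f v = c v" if "v \<notin> T" for v using that MT by (auto simp: f_def)
  ultimately show ?thesis by blast
qed

context sym_graph
begin

text \<open>The vertices \<open>T\<close> of \<open>R\<close> that cannot be satisfied inside their own class have only finitely many
  neighbors of finite degree. Changing their colors is repaired by flipping vertices of finite degree
  only, so the colors of all other vertices of infinite degree may be fixed before those of \<open>T\<close>.\<close>

lemma solvable_glue_inf:
  fixes lab lev :: "'a \<Rightarrow> nat"
  assumes R: "R \<subseteq> D" "countable R" "\<And>r. r \<in> R \<Longrightarrow> \<not> fd r"
    and lab: "\<And>u w. u \<in> D - R \<Longrightarrow> w \<in> D - R \<Longrightarrow> w \<in> N u \<Longrightarrow> lab u = lab w"
    and lev_le: "\<And>u r. u \<in> D - R \<Longrightarrow> r \<in> R \<Longrightarrow> r \<in> N u \<Longrightarrow> lev r \<le> lab u"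
    and lev_eq: "\<And>u r. u \<in> D - R \<Longrightarrow> r \<in> R \<Longrightarrow> r \<in> N u \<Longrightarrow> fd u \<Longrightarrow> lev r = lab u"
    and fin: "\<And>n. finite {r \<in> R. lev r \<le> n}"
    and sol: "\<And>i. solvable {u \<in> D - R. lab u = i}"
  shows "solvable D"
  unfolding solvable_def
proof
  fix k
  define A where "A = (\<lambda>i. {u \<in> D - R. lab u = i})"
  define T where "T = {r \<in> R. infinite (N r \<inter> D) \<and> finite (N r \<inter> A (lev r))}"
  \<comment> \<open>A vertex of \<open>R\<close> joins the class of its level. So \<open>B i\<close>
    is \<open>A i\<close> together with the finitely many vertices of \<open>R - T\<close> of level
    \<open>i\<close>, and is solvable by finite extension.\<close>
  define lb where "lb = (\<lambda>v. if v \<in> R then lev v else lab v)"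
  define B where "B = (\<lambda>i. {v \<in> D - T. lb v = i})"
  have TR: "T \<subseteq> R" by (auto simp: T_def)
  have AB: "A i \<subseteq> B i" for i using TR by (auto simp: A_def B_def lb_def)
  have "solvable (B i)" for i
  proof (rule solvable_finite_extension)
    show "finite {r \<in> R. lev r \<le> i}" by (rule fin)
    have "B i - {r \<in> R. lev r \<le> i} = A i" using TR by (auto simp: A_def B_def lb_def)
    then show "solvable (B i - {r \<in> R. lev r \<le> i})" using sol[of i] by (simp add: A_def)
  qed
  then have "\<exists>c. (\<forall>v. v \<notin> B i \<longrightarrow> c v = k v) \<and> strongly_maximal E c (B i) \<and> (\<forall>l\<in>B i. happy (B i) c l)" for i
    by (simp add: solvable_def)
  then obtain s where s: "\<And>i v. v \<notin> B i \<Longrightarrow> s i v = k v" "\<And>i. strongly_maximal E (s i) (B i)"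
    "\<And>i l. l \<in> B i \<Longrightarrow> happy (B i) (s i) l" by metis
  define c0 where "c0 = (\<lambda>v. if v \<in> D - T then s (lb v) v else k v)"
  have c0_k: "c0 v = k v" if "v \<notin> D - T" for v using that by (auto simp: c0_def)
  have c0_B: "c0 v = s i v" if "v \<in> B i" for v i using that by (auto simp: c0_def B_def)
  have nbr: "w \<in> B i \<or> w \<notin> D - T" if "u \<in> A i" "fd u" "w \<in> N u" for u w i
    using that lab[of u w] lev_eq[of u w] by (auto simp: A_def B_def lb_def)
  have c0_sm: "strongly_maximal E c0 (A i)" for i
  proof (rule strongly_maximal_cong)
    show "strongly_maximal E (s i) (A i)" using s(2)[of i] AB[of i] by (auto simp: strongly_maximal_def)
    fix u assume u: "u \<in> A i" "fd u"
    show "s i u = c0 u" using c0_B[of u i] u AB by auto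
    fix w assume w: "w \<in> N u"
    show "s i w = c0 w"
      using nbr[OF u w] c0_B[of w i] c0_k[of w] s(1)[of w i] by (cases "w \<in> B i") auto
  qed
  define X where "X = {v \<in> D - T. \<not> fd v}"
  \<comment> \<open>By \<open>lev_eq\<close>, the neighbors of \<open>t\<close> in \<open>D\<close>
    of finite degree all lie in \<open>A (lev t)\<close>, which contains only finitely many
    neighbors of \<open>t\<close>.\<close>
  have "infinite (N t \<inter> (T \<union> X))" if t: "t \<in> T" for t
  proof -
    have "N t \<inter> D \<subseteq> (N t \<inter> A (lev t)) \<union> (N t \<inter> (T \<union> X))"
    proof
      fix u assume u: "u \<in> N t \<inter> D"
      show "u \<in> (N t \<inter> A (lev t)) \<union> (N t \<inter> (T \<union> X))"
      proof (cases "fd u")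
        case True
        then have "u \<in> D - R" using u R(3) by auto
        moreover have "lev t = lab u" using lev_eq[OF calculation] t TR True u N_sym by blast
        ultimately show ?thesis using u by (auto simp: A_def)
      next
        case False then show ?thesis using u by (auto simp: X_def)
      qed
    qed
    moreover have "infinite (N t \<inter> D)" "finite (N t \<inter> A (lev t))" using t by (auto simp: T_def)
    ultimately show ?thesis by (meson finite_UnI finite_subset)
  qed
  moreover have "countable T" using R(2) TR countable_subset by blast
  moreover have "T \<inter> X = {}" by (auto simp: X_def)
  ultimately obtain f where f: "\<And>v. v \<notin> T \<Longrightarrow> f v = c0 v"
    "\<And>t. t \<in> T \<Longrightarrow> infinite {u \<in> N t \<inter> (T \<union> X). f u \<noteq> f t}"
    using infinitely_many_opposite[of T X N c0] by blast
  have "\<exists>Z\<in>finsets (A i). strongly_maximal E (flip f Z) (A i)" for i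
  proof (rule repair_perturbed[OF c0_sm[of i], of f])
    show "f v = c0 v" if "v \<in> A i" for v using f(1)[of v] that TR by (auto simp: A_def)
    \<comment> \<open>Only \<open>T\<close> was recolored, so an affected \<open>u\<close> has a
      neighbor in \<open>T\<close> of level \<open>i\<close>. There are finitely many such vertices,
      each with finitely many neighbors in its class.\<close>
    have "{u \<in> A i. fd u \<and> (\<exists>w\<in>N u. c0 w \<noteq> c0 u \<and> f w \<noteq> c0 w)} \<subseteq>
        (\<Union>t\<in>{r \<in> R. lev r \<le> i} \<inter> T. N t \<inter> A (lev t))"
    proof
      fix u assume "u \<in> {u \<in> A i. fd u \<and> (\<exists>w\<in>N u. c0 w \<noteq> c0 u \<and> f w \<noteq> c0 w)}"
      then obtain w where u: "u \<in> A i" "fd u" and w: "w \<in> N u" "f w \<noteq> c0 w" by blast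
      have wT: "w \<in> T" using f(1) w by blast
      then have "lev w = i" using lev_eq[of u w] u w TR by (auto simp: A_def)
      then show "u \<in> (\<Union>t\<in>{r \<in> R. lev r \<le> i} \<inter> T. N t \<inter> A (lev t))"
        using wT TR u w N_sym by blast
    qed
    moreover have "finite (\<Union>t\<in>{r \<in> R. lev r \<le> i} \<inter> T. N t \<inter> A (lev t))"
      using fin[of i] by (auto simp: T_def)
    ultimately show "finite {u \<in> A i. fd u \<and> (\<exists>w\<in>N u. c0 w \<noteq> c0 u \<and> f w \<noteq> c0 w)}"
      by (rule finite_subset)
  qed blast
  then obtain Z where Z: "\<And>i. Z i \<in> finsets (A i)" "\<And>i. strongly_maximal E (flip f (Z i)) (A i)" by metis
  define c where "c = flip f (\<Union>i. Z i)"
  have ZA: "Z i \<subseteq> A i" "finite (Z i)" "\<And>v. v \<in> Z i \<Longrightarrow> fd v" for i using Z(1)[of i] by (auto simp: finsets_def)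
  have c_nfd: "c v = f v" if "\<not> fd v" for v using that ZA(3) by (auto simp: c_def flip_def)
  have Z_iff: "v \<in> (\<Union>i. Z i) \<longleftrightarrow> v \<in> Z i" if "v \<in> B i" for v i
    using that ZA(1) AB by (fastforce simp: B_def)
  have c_B: "c v = flip f (Z i) v" if "v \<in> B i" for v i using Z_iff[OF that] by (simp add: c_def flip_def)
  have c_notB: "c v = f v" if "v \<notin> D - T" for v
  proof -
    have "v \<notin> (\<Union>i. Z i)" using that ZA(1) TR by (auto simp: A_def)
    then show ?thesis by (simp add: c_def flip_def)
  qed
  have c_smA: "strongly_maximal E c (A i)" for i
  proof (rule strongly_maximal_cong[OF Z(2)[of i]])
    fix u assume u: "u \<in> A i" "fd u"
    show "flip f (Z i) u = c u" using c_B[of u i] u AB by auto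
    fix w assume w: "w \<in> N u"
    show "flip f (Z i) w = c w"
    proof (cases "w \<in> B i")
      case True then show ?thesis using c_B by simp
    next
      case False
      then have "w \<notin> D - T" using nbr[OF u w] by auto
      then show ?thesis using c_notB[of w] False ZA(1)[of i] AB[of i] by (auto simp: flip_def)
    qed
  qed
  have smU: "strongly_maximal E c (D - R)"
    by (rule strongly_maximal_labels[where lab = lab]) (use lab c_smA in \<open>auto simp: A_def\<close>)
  have sm: "strongly_maximal E c D"
    unfolding strongly_maximal_iff
  proof
    fix F assume "F \<in> finsets D"
    then have "F \<in> finsets (D - R)" using R(3) by (auto simp: finsets_def)
    then show "0 \<le> gain c F" using smU by (simp add: strongly_maximal_iff)
  qed
  have "happy D c l" if l: "l \<in> D" for l
  proof (cases "fd l")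
    case True then show ?thesis by (rule happy_fd)
  next
    case nfd: False
    show ?thesis
    proof (cases "l \<in> T")
      case True
      have "{u \<in> N l \<inter> (T \<union> X). f u \<noteq> f l} \<subseteq> {u \<in> N l \<inter> D. c u \<noteq> c l}"
      proof -
        have "T \<union> X \<subseteq> {v \<in> D. \<not> fd v}" using TR R by (auto simp: X_def)
        then show ?thesis using c_nfd nfd by auto
      qed
      then show ?thesis using f(2)[OF True] finite_subset by (auto simp: happy_def)
    next
      case False
      define i where "i = lb l"
      have lB: "l \<in> B i" using l False by (auto simp: B_def i_def)
      show ?thesis
      proof (rule happy_transfer[OF s(3)[OF lB]])
        show "c l = s i l" using c_nfd[OF nfd] f(1)[OF False] c0_B[OF lB] by simp
        have "{u \<in> N l \<inter> B i. \<not> (u \<in> D \<and> c u = s i u)} \<subseteq> Z i"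
        proof
          fix u assume u: "u \<in> {u \<in> N l \<inter> B i. \<not> (u \<in> D \<and> c u = s i u)}"
          then have "u \<notin> T" by (auto simp: B_def)
          then show "u \<in> Z i" using u c_B[of u i] f(1)[of u] c0_B[of u i] by (auto simp: flip_def B_def split: if_splits)
        qed
        then show "finite {u \<in> N l \<inter> B i. \<not> (u \<in> D \<and> c u = s i u)}"
          using ZA(2) finite_subset by blast
        assume inf: "infinite (N l \<inter> D)"
        \<comment> \<open>For \<open>l\<close> in \<open>R\<close> this is what not being in
          \<open>T\<close> means. For other \<open>l\<close>, the neighbors in \<open>R\<close> have
          level at most \<open>i\<close>, so there are finitely many, and the remaining ones in
          \<open>D\<close> have label \<open>i\<close>.\<close>
        have "infinite (N l \<inter> A i)"
        proof (cases "l \<in> R")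
          case True
          then show ?thesis using False inf by (auto simp: T_def i_def lb_def)
        next
          case lR: False
          have "N l \<inter> D \<subseteq> (N l \<inter> A i) \<union> {r \<in> R. lev r \<le> i}"
          proof
            fix u assume u: "u \<in> N l \<inter> D"
            then show "u \<in> (N l \<inter> A i) \<union> {r \<in> R. lev r \<le> i}"
              using lab[of l u] lev_le[of l u] l lR by (cases "u \<in> R") (auto simp: A_def i_def lb_def)
          qed
          then show ?thesis using inf fin[of i] by (meson finite_UnI finite_subset)
        qed
        moreover have "N l \<inter> A i \<subseteq> N l \<inter> B i" using AB by auto
        ultimately show "infinite (N l \<inter> B i)" using finite_subset by blast
      qed
    qed
  qed
  moreover have "c v = k v" if "v \<notin> D" for v
    using c_notB[of v] f(1)[of v] c0_k[of v] that TR R(1) by auto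
  ultimately show "\<exists>c. (\<forall>v. v \<notin> D \<longrightarrow> c v = k v) \<and> strongly_maximal E c D \<and> (\<forall>l\<in>D. happy D c l)"
    using sm by blast
qed

subsection \<open>Decomposing a connected set\<close>

definition reach :: "'a set \<Rightarrow> 'a \<Rightarrow> 'a \<Rightarrow> bool" where
  "reach W = (\<lambda>a b. E a b \<and> a \<in> W \<and> b \<in> W)\<^sup>*\<^sup>*"

text \<open>For \<open>y\<close> outside \<open>W\<close> this is just \<open>{y}\<close>, since a
  nontrivial step needs both ends in \<open>W\<close>.\<close>

definition component :: "'a set \<Rightarrow> 'a \<Rightarrow> 'a set" where
  "component W y = {z. reach W y z}"

lemma reach_refl [simp]: "reach W y y"
  by (simp add: reach_def)

lemma reach_trans: "reach W x y \<Longrightarrow> reach W y z \<Longrightarrow> reach W x z"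
  unfolding reach_def by (rule rtranclp_trans)

lemma reach_step: "reach W x y \<Longrightarrow> E y z \<Longrightarrow> y \<in> W \<Longrightarrow> z \<in> W \<Longrightarrow> reach W x z"
  unfolding reach_def by (simp add: rtranclp.rtrancl_into_rtrancl)

lemma reach_sym: "reach W x y \<Longrightarrow> reach W y x"
proof -
  have "symp (\<lambda>a b. E a b \<and> a \<in> W \<and> b \<in> W)" using sym by (auto simp: symp_def)
  then show "reach W x y \<Longrightarrow> reach W y x" unfolding reach_def by (meson symp_rtranclp sympD)
qed

lemma reach_mono: "reach W x y \<Longrightarrow> W \<subseteq> W' \<Longrightarrow> reach W' x y"
  unfolding reach_def by (rule rtranclp_mono[THEN predicate2D]) auto

lemma reach_induct [consumes 1, case_names refl step]:
  assumes "reach W x y" and "P x"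
    and "\<And>y z. reach W x y \<Longrightarrow> P y \<Longrightarrow> E y z \<Longrightarrow> y \<in> W \<Longrightarrow> z \<in> W \<Longrightarrow> P z"
  shows "P y"
  using assms(1) unfolding reach_def
  by (induction rule: rtranclp_induct) (use assms(2,3) in \<open>auto simp: reach_def\<close>)

lemma reach_in: "reach W x y \<Longrightarrow> x \<in> W \<Longrightarrow> y \<in> W"
  by (induction rule: reach_induct) auto

lemma component_eq: "reach W x y \<Longrightarrow> component W x = component W y"
  unfolding component_def using reach_trans reach_sym by blast

lemma component_self: "x \<in> component W x"
  by (simp add: component_def)

lemma component_subset: "x \<in> W \<Longrightarrow> component W x \<subseteq> W"
  using reach_in by (auto simp: component_def)

lemma reach_component: "reach W x y \<Longrightarrow> reach (component W x) x y"
proof (induction rule: reach_induct)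
  case (step y z)
  then show ?case using reach_step[of W x y z] by (intro reach_step[of _ x y z]) (auto simp: component_def)
qed simp

text \<open>Stop the walk just before its first visit to \<open>v\<close>.\<close>

lemma reach_avoid:
  assumes "reach W u v" "u \<noteq> v"
  shows "\<exists>y. reach (W - {v}) u y \<and> E y v"
proof -
  have "(z \<noteq> v \<and> reach (W - {v}) u z) \<or> (\<exists>y. reach (W - {v}) u y \<and> E y v)" if "reach W u z" for z
    using that
  proof (induction rule: reach_induct)
    case refl then show ?case using assms(2) by simp
  next
    case (step y z)
    show ?case
    proof (cases "\<exists>y. reach (W - {v}) u y \<and> E y v")
      case False
      then have "y \<noteq> v" "reach (W - {v}) u y" "z \<noteq> v" using step by auto
      then show ?thesis using step reach_step[of "W - {v}" u y z] by auto
    qed simp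
  qed
  then show ?thesis using assms(1) by blast
qed

lemma reach_path:
  assumes "reach W x q" "x \<in> W"
  shows "\<exists>p. p \<noteq> [] \<and> hd p = x \<and> last p = q \<and> distinct p \<and> set p \<subseteq> W \<and> successively E p"
  using assms(1)
proof (induction rule: reach_induct)
  case refl
  show ?case using assms(2) by (intro exI[of _ "[x]"]) auto
next
  case (step y z)
  then obtain p where p: "p \<noteq> []" "hd p = x" "last p = y" "distinct p" "set p \<subseteq> W" "successively E p" by blast
  show ?case
  proof (cases "z \<in> set p")
    case True
    then obtain a b where ab: "p = a @ z # b" by (auto simp: in_set_conv_decomp)
    then show ?thesis using p
      by (intro exI[of _ "a @ [z]"]) (auto simp: successively_append_iff hd_append)
  next
    case False
    then show ?thesis using p step
      by (intro exI[of _ "p @ [z]"]) (auto simp: successively_append_iff)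
  qed
qed

definition hereditarily_solvable :: "'a set \<Rightarrow> bool" where
  "hereditarily_solvable D \<longleftrightarrow> (\<forall>X. finite X \<longrightarrow> solvable (D - X))"

definition link :: "'a set \<Rightarrow> 'a \<Rightarrow> 'a list \<Rightarrow> 'a \<Rightarrow> bool" where
  "link D x p w \<longleftrightarrow> p \<noteq> [] \<and> hd p = x \<and> distinct p \<and> successively E p \<and>
     set p \<subseteq> {v \<in> D. fd v = fd x} \<and> w \<in> D \<and> fd w \<noteq> fd x \<and> E (last p) w"

text \<open>A path inside \<open>X\<close> from \<open>x\<close> to \<open>q\<close>, followed by
  \<open>w\<close>, is a link. Without \<open>w\<close>, the component falls into pieces governed by
  hereditarily solvable components at \<open>w\<close>; putting \<open>w\<close> back is a finite
  extension.\<close>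

lemma hereditarily_solvable_attached:
  assumes IH: "\<And>p w y. link D x p w \<Longrightarrow> y \<in> D - set p - {w} \<Longrightarrow> E w y \<Longrightarrow> hereditarily_solvable (component (D - set p - {w}) y)"
    and X: "finite X" "X \<subseteq> {v \<in> D. fd v = fd x}" "\<And>v. v \<in> X \<Longrightarrow> reach X x v" "x \<in> X"
    and y: "y \<in> D - X" and w: "w \<in> component (D - X) y" "fd w \<noteq> fd x" and q: "q \<in> X" "E q w"
  shows "hereditarily_solvable (component (D - X) y)"
  unfolding hereditarily_solvable_def
proof (intro allI impI)
  fix X0 :: "'a set" assume X0: "finite X0"
  define Y where "Y = component (D - X) y"
  have YD: "Y \<subseteq> D - X" unfolding Y_def using component_subset[OF y] .
  obtain p where p: "p \<noteq> []" "hd p = x" "last p = q" "distinct p" "set p \<subseteq> X" "successively E p"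
    using reach_path[OF X(3)[OF q(1)] X(4)] by blast
  have lk: "link D x p w" using p X(2) w q YD by (auto simp: link_def Y_def)
  define B where "B = D - set p - {w}"
  have YB: "Y - {w} \<subseteq> B" using YD p(5) by (auto simp: B_def)
  have "solvable (Y - X0 - {w})"
  proof (rule solvable_labels[where lab = "component B"])
    fix u v assume "u \<in> Y - X0 - {w}" "v \<in> Y - X0 - {w}" "v \<in> N u"
    then show "component B u = component B v"
      using YB by (intro component_eq reach_step[of B u u v]) (auto simp: nbhd_def)
  next
    fix i
    let ?A = "{u \<in> Y - X0 - {w}. component B u = i}"
    show "solvable ?A"
    proof (cases "?A = {}")
      case True
      then show ?thesis by (simp only: solvable_empty)
    next
      case False
      then obtain u where u: "u \<in> Y - X0 - {w}" "component B u = i" by blast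
      have yu: "reach (D - X) y u" and yw: "reach (D - X) y w" using u(1) w(1) by (auto simp: Y_def component_def)
      have "reach (D - X) u w" using reach_trans[OF reach_sym[OF yu] yw] .
      then have "reach (component (D - X) u) u w" by (rule reach_component)
      moreover have "component (D - X) u = Y" using component_eq[OF yu] by (simp add: Y_def)
      ultimately have "reach Y u w" by simp
      \<comment> \<open>The last vertex before \<open>w\<close> on a walk from \<open>u\<close> is a
        neighbor of \<open>w\<close> in the component \<open>i\<close> of \<open>B\<close>, so
        \<open>IH\<close> applies to \<open>i\<close>.\<close>
      then obtain z where z: "reach (Y - {w}) u z" "E z w" using reach_avoid u by blast
      then have zB: "reach B u z" using YB reach_mono by blast
      have "z \<in> B" using reach_in[OF z(1)] u YB by blast
      then have "hereditarily_solvable (component B z)" using IH[OF lk] sym[OF z(2)] by (simp add: B_def)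
      then have "hereditarily_solvable i" using component_eq[OF zB] u(2) by simp
      \<comment> \<open>Vertices of \<open>X\<close> off the path may lie in \<open>i\<close>; once
        they are removed too, no edge leads from \<open>?A\<close> to the rest of
        \<open>i\<close>.\<close>
      then have "solvable (i - (X0 \<union> X))" using X0 X(1) by (simp add: hereditarily_solvable_def)
      then show ?thesis
      proof (rule solvable_subset)
        show "?A \<subseteq> i - (X0 \<union> X)" using YD component_self by blast
        have iB: "i \<subseteq> B" using u YB component_subset[of u B] by blast
        fix a b assume a: "a \<in> ?A" and b: "b \<in> N a" "b \<in> i - (X0 \<union> X)"
        have bB: "b \<in> B" using b iB by blast
        have aB: "a \<in> B" using a YB by blast
        have "b \<in> Y" unfolding Y_def component_def
        proof (rule CollectI, rule reach_step[of _ y a])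
          show "reach (D - X) y a" using a by (simp add: Y_def component_def)
          show "E a b" using b by (simp add: nbhd_def)
          show "a \<in> D - X" using a YD by blast
          show "b \<in> D - X" using bB b by (auto simp: B_def)
        qed
        moreover have "component B a = component B b"
          using b aB bB by (intro component_eq reach_step[of B a a b]) (auto simp: nbhd_def)
        ultimately show "b \<in> ?A" using a b bB by (auto simp: B_def)
      qed
    qed
  qed
  then show "solvable (component (D - X) y - X0)"
    unfolding Y_def[symmetric] by (rule solvable_finite_extension[rotated]) simp
qed

text \<open>Exhaust the component of \<open>x\<close> among the vertices of its degree type by finite connected
  sets \<open>X n\<close> and cut off, at the first possible \<open>n\<close>, every component of \<open>D - X n\<close> that contains a
  neighbor of \<open>X n\<close> of the other type. The vertices never cut off all have the type of \<open>x\<close>.\<close>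

lemma hereditarily_solvable_step:
  assumes x: "x \<in> D" and con: "\<And>y. y \<in> D \<Longrightarrow> reach D x y" and cnt: "countable D"
    and IH: "\<And>p w y. link D x p w \<Longrightarrow> y \<in> D - set p - {w} \<Longrightarrow> E w y \<Longrightarrow> hereditarily_solvable (component (D - set p - {w}) y)"
  shows "hereditarily_solvable D"
proof -
  define C where "C = (\<lambda>n. {v \<in> D. fd v = fd x \<and> to_nat_on D v \<le> n})"
  \<comment> \<open>The component of \<open>x\<close> in \<open>C n\<close>, and empty as long as
    \<open>x\<close> itself is not in \<open>C n\<close>.\<close>
  define X where "X = (\<lambda>n. {v. x \<in> C n \<and> reach (C n) x v})"
  have C_mono: "C m \<subseteq> C n" if "m \<le> n" for m n using that by (auto simp: C_def)
  have X_mono: "X m \<subseteq> X n" if "m \<le> n" for m n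
    using C_mono[OF that] reach_mono by (auto simp: X_def)
  have XC: "X n \<subseteq> C n" for n using reach_in by (auto simp: X_def)
  have finC: "finite (C n)" for n
    by (rule finite_imageD[of "to_nat_on D"], rule finite_subset[of _ "{..n}"])
      (auto simp: C_def intro: inj_on_subset[OF inj_on_to_nat_on[OF cnt]])
  have finX: "finite (X n)" for n using finite_subset[OF XC finC] .
  have Xty: "X n \<subseteq> {v \<in> D. fd v = fd x}" for n using XC[of n] by (auto simp: C_def)
  have Xne: "x \<in> X n" "reach (X n) x v" if "v \<in> X n" for v n
  proof -
    have "X n = component (C n) x" using that by (auto simp: X_def component_def)
    then show "x \<in> X n" "reach (X n) x v" using that reach_component by (auto simp: component_def)
  qed
  define captured where "captured = (\<lambda>n y. y \<in> D - X n \<and>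
    (\<exists>w\<in>component (D - X n) y. fd w \<noteq> fd x \<and> (\<exists>q\<in>X n. E q w)))"
  define U where "U = {y. \<exists>n. captured n y}"
  define lab where "lab = (\<lambda>y. LEAST n. captured n y)"
  define R where "R = D - U"
  define lev where "lev = (\<lambda>r. LEAST n. r \<in> X n)"
  have lab_cap: "captured (lab y) y" if "y \<in> U" for y
    using that unfolding U_def lab_def by (auto intro: LeastI)
  have lab_le: "y \<in> U" "lab y \<le> n" if "captured n y" for y n
    using that unfolding U_def lab_def by (auto intro: Least_le)
  have UD: "U \<subseteq> D" by (auto simp: U_def captured_def)
  have cap_reach: "captured n z" if "captured n y" "reach (D - X n) y z" for n y z
  proof -
    have "z \<in> D - X n" using reach_in[OF that(2)] that(1) by (simp add: captured_def)
    moreover have "component (D - X n) z = component (D - X n) y" using component_eq[OF that(2)] by simp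
    ultimately show ?thesis using that(1) by (simp add: captured_def)
  qed
  have cap_edge: "captured n z" if "captured n y" "z \<in> N y" "z \<in> D" "z \<notin> X n" for n y z
    by (rule cap_reach[OF that(1)], rule reach_step[of _ y y])
      (use that in \<open>auto simp: nbhd_def captured_def\<close>)
  \<comment> \<open>If \<open>a\<close> is captured no later than its neighbor \<open>b\<close>,
    then \<open>b\<close> is still outside \<open>X (lab a)\<close> and is captured together with
    \<open>a\<close>.\<close>
  have lab_edge: "lab u = lab w" if uw: "u \<in> U" "w \<in> U" "w \<in> N u" for u w
  proof -
    have *: "lab b \<le> lab a" if ab: "a \<in> U" "b \<in> U" "b \<in> N a" "lab a \<le> lab b" for a b
    proof -
      have "b \<notin> X (lab b)" using lab_cap[OF ab(2)] by (simp add: captured_def)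
      then have "b \<notin> X (lab a)" using X_mono[OF ab(4)] by blast
      then show ?thesis using cap_edge[OF lab_cap[OF ab(1)] ab(3)] ab(2) UD lab_le by blast
    qed
    show ?thesis using *[of u w] *[of w u] uw N_sym by (meson le_antisym nle_le)
  qed
  \<comment> \<open>A walk from \<open>r\<close> to \<open>x\<close> enters \<open>X'\<close> from
    some vertex \<open>a\<close>. If \<open>a\<close> had the type of \<open>x\<close>, it would
    itself belong to some \<open>X m\<close>; so it has the other type, and \<open>r\<close> is
    captured.\<close>
  have RX: "\<exists>n. r \<in> X n" if r: "r \<in> R" for r
  proof (rule ccontr)
    assume nr: "\<nexists>n. r \<in> X n"
    define X' where "X' = (\<Union>n. X n)"
    have rD: "r \<in> D" "r \<notin> X'" using r nr by (auto simp: R_def X'_def)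
    have xX': "x \<in> X'"
      using x by (auto simp: X'_def X_def C_def)
    have "reach D r x" using con[OF rD(1)] by (rule reach_sym)
    then have "(x \<notin> X' \<and> reach (D - X') r x) \<or> (\<exists>a b. reach (D - X') r a \<and> a \<in> D - X' \<and> b \<in> X' \<and> E a b)"
    proof (induction rule: reach_induct)
      case refl then show ?case using rD by simp
    next
      case (step y z)
      show ?case
      proof (cases "\<exists>a b. reach (D - X') r a \<and> a \<in> D - X' \<and> b \<in> X' \<and> E a b")
        case False
        then have y: "y \<notin> X'" "reach (D - X') r y" using step by auto
        then have "z \<notin> X'" using False step by blast
        then show ?thesis using y step reach_step[of "D - X'" r y z] by auto
      qed simp
    qed
    then obtain a b where ab: "reach (D - X') r a" "a \<in> D - X'" "b \<in> X'" "E a b" using xX' by blast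
    then obtain n where n: "b \<in> X n" by (auto simp: X'_def)
    have ty: "fd a \<noteq> fd x"
    proof
      assume "fd a = fd x"
      define m where "m = max n (to_nat_on D a)"
      have "a \<in> C m" using ab \<open>fd a = fd x\<close> by (auto simp: C_def m_def)
      moreover have "b \<in> X m" using X_mono[of n m] n by (auto simp: m_def)
      ultimately have "a \<in> X m"
        using reach_step[of "C m" x b a] sym[OF ab(4)] XC[of m] by (auto simp: X_def)
      then show False using ab by (auto simp: X'_def)
    qed
    have "reach (D - X n) r a" using ab(1) by (rule reach_mono) (auto simp: X'_def)
    then have "captured n r" using ty n sym[OF ab(4)] rD
      by (auto simp: captured_def component_def X'_def)
    then show False using r lab_le by (auto simp: R_def)
  qed
  have R_lev: "r \<in> X (lev r)" if "r \<in> R" for r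
    using RX[OF that] unfolding lev_def by (auto intro: LeastI)
  have lev_X: "lev r \<le> n" if "r \<in> X n" for r n
    using that unfolding lev_def by (rule Least_le)
  have UR: "r \<in> X (lab u)" if "u \<in> U" "r \<in> R" "r \<in> N u" for u r
    using cap_edge[OF lab_cap[OF that(1)] that(3)] that(2) lab_le(1) by (auto simp: R_def)
  have lev_le: "lev r \<le> lab u" if "u \<in> U" "r \<in> R" "r \<in> N u" for u r
    using UR[OF that] lev_X by blast
  \<comment> \<open>A vertex \<open>u\<close> of the other type is captured as soon as its neighbor
    \<open>r\<close> enters some \<open>X n\<close>: it serves as its own witness.\<close>
  have lev_eq: "lev r = lab u" if u: "u \<in> U" "r \<in> R" "r \<in> N u" "fd u \<noteq> fd x" for u r
  proof (rule antisym[OF lev_le[OF u(1-3)]])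
    have "u \<notin> X (lev r)" using Xty u(4) by auto
    then have "captured (lev r) u" using u R_lev[OF u(2)] UD component_self N_sym
      by (fastforce simp: captured_def nbhd_def)
    then show "lab u \<le> lev r" by (rule lab_le)
  qed
  have R_ty: "fd r = fd x" if "r \<in> R" for r using RX[OF that] Xty by blast
  have R_fin: "finite {r \<in> R. lev r \<le> n}" for n
  proof (rule finite_subset[OF _ finX[of n]])
    show "{r \<in> R. lev r \<le> n} \<subseteq> X n" using R_lev X_mono by blast
  qed
  have component_hered: "hereditarily_solvable (component (D - X n) y)" if cap: "captured n y" for n y
  proof -
    obtain w q where wq: "w \<in> component (D - X n) y" "fd w \<noteq> fd x" "q \<in> X n" "E q w" and y: "y \<in> D - X n"
      using cap by (auto simp: captured_def)
    show ?thesis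
      by (rule hereditarily_solvable_attached[OF IH finX Xty Xne(2) Xne(1)[OF wq(3)] y wq])
  qed
  show ?thesis
    unfolding hereditarily_solvable_def
  proof (intro allI impI)
    fix F :: "'a set" assume F: "finite F"
    have sol: "solvable {u \<in> D - F - (R - F). lab u = i}" for i
    proof (rule solvable_labels[where lab = "component (D - X i)"])
      let ?A = "{u \<in> D - F - (R - F). lab u = i}"
      have A: "?A = {u \<in> U - F. lab u = i}" using UD by (auto simp: R_def)
      have Acap: "captured i u" if "u \<in> ?A" for u using that lab_cap A by auto
      fix u w assume "u \<in> ?A" "w \<in> ?A" "w \<in> N u"
      then show "component (D - X i) u = component (D - X i) w"
        using Acap[of u] Acap[of w]
        by (intro component_eq reach_step[of _ u u w]) (auto simp: nbhd_def captured_def)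
    next
      fix i j
      let ?A = "{u \<in> D - F - (R - F). lab u = i}"
      have A: "?A = {u \<in> U - F. lab u = i}" using UD by (auto simp: R_def)
      show "solvable {u \<in> ?A. component (D - X i) u = j}" (is "solvable ?B")
      proof (cases "?B = {}")
        case True then show ?thesis by (simp only: solvable_empty)
      next
        case False
        then obtain u where u: "u \<in> ?A" "component (D - X i) u = j" by blast
        then have cap: "captured i u" using lab_cap A by auto
        \<comment> \<open>The label is constant on \<open>j\<close>: if \<open>z\<close> in
          \<open>j\<close> were captured before stage \<open>i\<close>, then \<open>u\<close>,
          connected to \<open>z\<close> outside an even smaller \<open>X (lab z)\<close>, would be
          captured then too.\<close>
        have "?B = j - F"
        proof
          show "?B \<subseteq> j - F" using component_self A by blast
          show "j - F \<subseteq> ?B"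
          proof
            fix z assume z: "z \<in> j - F"
            then have uz: "reach (D - X i) u z" using u by (auto simp: component_def)
            then have cz: "captured i z" using cap_reach[OF cap] by blast
            then have zU: "z \<in> U" "lab z \<le> i" using lab_le by auto
            have "reach (D - X (lab z)) z u"
              using reach_mono[OF reach_sym[OF uz]] X_mono[OF zU(2)] by blast
            then have "captured (lab z) u" using cap_reach[OF lab_cap[OF zU(1)]] by blast
            then have "lab z = i" using lab_le(2) u(1) zU(2) by fastforce
            then show "z \<in> ?B" using z zU A component_eq[OF uz] u(2) by auto
          qed
        qed
        moreover have "hereditarily_solvable j" using component_hered[OF cap] u(2) by simp
        ultimately show ?thesis using F by (simp add: hereditarily_solvable_def)
      qed
    qed
    have DU: "u \<in> U" if "u \<in> D - F - (R - F)" for u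
      using that by (auto simp: R_def)
    show "solvable (D - F)"
    proof (cases "fd x")
      case True
      show ?thesis
      proof (rule solvable_glue_fd[where R = "R - F" and lab = lab])
        show "R - F \<subseteq> D - F" "countable (R - F)" using cnt by (auto simp: R_def)
        show "fd r" if "r \<in> R - F" for r using that R_ty True by auto
        show "lab u = lab w" if "u \<in> D - F - (R - F)" "w \<in> D - F - (R - F)" "w \<in> N u" for u w
          using lab_edge[OF DU DU] that by blast
        show "finite {r \<in> R - F. \<exists>u\<in>D - F - (R - F). lab u = i \<and> r \<in> N u}" for i
          by (rule finite_subset[OF _ finX[of i]]) (use DU UR in blast)
      qed (rule sol)
    next
      case False
      show ?thesis
      proof (rule solvable_glue_inf[where R = "R - F" and lab = lab and lev = lev])
        show "R - F \<subseteq> D - F" "countable (R - F)" using cnt by (auto simp: R_def)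
        show "\<not> fd r" if "r \<in> R - F" for r using that R_ty False by auto
        show "lab u = lab w" if "u \<in> D - F - (R - F)" "w \<in> D - F - (R - F)" "w \<in> N u" for u w
          using lab_edge[OF DU DU] that by blast
        show "lev r \<le> lab u" if "u \<in> D - F - (R - F)" "r \<in> R - F" "r \<in> N u" for u r
          using lev_le[OF DU] that by blast
        show "lev r = lab u" if "u \<in> D - F - (R - F)" "r \<in> R - F" "r \<in> N u" "fd u" for u r
          using lev_eq[OF DU] that False by blast
        show "finite {r \<in> R - F. lev r \<le> n}" for n
          by (rule finite_subset[OF _ R_fin[of n]]) blast
      qed (rule sol)
    qed
  qed
qed

subsection \<open>Alternating rays\<close>

definition obstructed :: "'a set \<Rightarrow> 'a \<Rightarrow> bool" where
  "obstructed D x \<longleftrightarrow> x \<in> D \<and> (\<forall>y\<in>D. reach D x y) \<and> countable D \<and> \<not> hereditarily_solvable D"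

lemma obstructed_component: "x \<in> W \<Longrightarrow> countable W \<Longrightarrow> \<not> hereditarily_solvable (component W x) \<Longrightarrow> obstructed (component W x) x"
  unfolding obstructed_def using component_self reach_component component_subset[of x W] countable_subset[of "component W x" W]
  by (auto simp: component_def)

text \<open>By \<open>hereditarily_solvable_step\<close>, some link fails the hypothesis. Its path
  together with \<open>w\<close> contains both degree types, and the component of the remainder that
  fails is obstructed.\<close>

lemma obstructed_step:
  assumes "obstructed D x"
  obtains p D' y where "p \<noteq> []" "hd p = x" "distinct p" "successively E p" "set p \<subseteq> D"
    "D' \<subseteq> D - set p" "E (last p) y" "obstructed D' y" "\<exists>a\<in>set p. fd a" "\<exists>a\<in>set p. \<not> fd a"
proof -
  obtain p w y where lk: "link D x p w" and y: "y \<in> D - set p - {w}" "E w y"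
    and nh: "\<not> hereditarily_solvable (component (D - set p - {w}) y)"
    using assms hereditarily_solvable_step[of x D] unfolding obstructed_def by blast
  let ?D' = "component (D - set p - {w}) y"
  have "obstructed ?D' y" using obstructed_component[OF y(1) _ nh] assms by (simp add: obstructed_def)
  moreover have "?D' \<subseteq> D - set (p @ [w])" using component_subset[OF y(1)] by auto
  moreover have ne: "p \<noteq> []" and ty: "set p \<subseteq> {v \<in> D. fd v = fd x}" "w \<in> D" "fd w \<noteq> fd x"
    using lk by (auto simp: link_def)
  moreover have "distinct (p @ [w])" "successively E (p @ [w])" "hd (p @ [w]) = x"
    using lk ne ty by (auto simp: link_def successively_append_iff)
  moreover have "\<exists>a\<in>set (p @ [w]). fd a" "\<exists>a\<in>set (p @ [w]). \<not> fd a"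
  proof -
    have "last p \<in> set p" using ne by simp
    then have "fd (last p) \<noteq> fd w" "last p \<in> set (p @ [w])" "w \<in> set (p @ [w])" using ty by auto
    then show "\<exists>a\<in>set (p @ [w]). fd a" "\<exists>a\<in>set (p @ [w]). \<not> fd a" by metis+
  qed
  moreover have "set (p @ [w]) \<subseteq> D" using ty by auto
  ultimately show thesis using that[of "p @ [w]" ?D' y] y(2) by simp
qed

text \<open>Iterating \<open>obstructed_step\<close> and concatenating the paths gives the ray; it
  is read off one vertex per step.\<close>

lemma obstructed_imp_alternating:
  assumes "obstructed D x"
  shows "\<exists>r::nat \<Rightarrow> 'a. inj r \<and> (\<forall>i. r i \<in> D \<and> E (r i) (r (Suc i))) \<and>
    infinite {i. fd (r i)} \<and> infinite {i. \<not> fd (r i)}"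
proof -
  \<comment> \<open>\<open>(p, D', y)\<close>: the unread part \<open>p\<close> of the current path, and the obstructed set entered at \<open>y\<close> after it.\<close>
  define inv where "inv = (\<lambda>(p, D', y). p \<noteq> [] \<and> distinct p \<and> successively E p \<and> set p \<union> D' \<subseteq> D \<and>
    set p \<inter> D' = {} \<and> E (last p) y \<and> obstructed D' y)"
  define nxt where "nxt = (\<lambda>(p, D', y :: 'a) (p', D'', y' :: 'a).
    if tl p \<noteq> [] then p' = tl p \<and> D'' = D' else
      hd p' = y \<and> set p' \<union> D'' \<subseteq> D' \<and> (\<exists>a\<in>set p'. fd a) \<and> (\<exists>a\<in>set p'. \<not> fd a))"
  have "\<exists>s. inv s"
  proof -
    obtain p D' y where "p \<noteq> []" "hd p = x" "distinct p" "successively E p" "set p \<subseteq> D"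
      "D' \<subseteq> D - set p" "E (last p) y" "obstructed D' y" using obstructed_step[OF assms] by metis
    then have "inv (p, D', y)" by (auto simp: inv_def)
    then show ?thesis ..
  qed
  moreover have "\<exists>s'. inv s' \<and> nxt s s'" if "inv s" for s
  proof -
    obtain p D' y where s: "s = (p, D', y)" by (cases s)
    have i: "p \<noteq> []" "distinct p" "successively E p" "set p \<union> D' \<subseteq> D"
      "set p \<inter> D' = {}" "E (last p) y" "obstructed D' y" using that by (auto simp: inv_def s)
    show ?thesis
    proof (cases "tl p = []")
      case False
      then obtain a b q where "p = a # b # q" by (cases p; cases "tl p") auto
      then have "inv (tl p, D', y) \<and> nxt s (tl p, D', y)" using i by (auto simp: inv_def nxt_def s)
      then show ?thesis ..
    next
      case True
      obtain p' D'' y' where "p' \<noteq> []" "hd p' = y" "distinct p'" "successively E p'" "set p' \<subseteq> D'"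
        "D'' \<subseteq> D' - set p'" "E (last p') y'" "obstructed D'' y'" "\<exists>a\<in>set p'. fd a" "\<exists>a\<in>set p'. \<not> fd a"
        using obstructed_step[OF i(7)] by metis
      then have "inv (p', D'', y') \<and> nxt s (p', D'', y')" using i(4) True by (auto simp: inv_def nxt_def s)
      then show ?thesis ..
    qed
  qed
  ultimately obtain st where st: "\<And>n. inv (st n)" "\<And>n. nxt (st n) (st (Suc n))"
    using dependent_nat_choice[of "\<lambda>_. inv" "\<lambda>_. nxt"] by blast
  define P where "P = (\<lambda>n. fst (st n))"
  define Q where "Q = (\<lambda>n. fst (snd (st n)))"
  define Y where "Y = (\<lambda>n. snd (snd (st n)))"
  have stn: "st n = (P n, Q n, Y n)" for n by (simp add: P_def Q_def Y_def)
  have inv: "P n \<noteq> []" "distinct (P n)" "successively E (P n)" "set (P n) \<union> Q n \<subseteq> D"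
    "set (P n) \<inter> Q n = {}" "E (last (P n)) (Y n)" for n
    using st(1)[of n] unfolding stn inv_def by auto
  have nx1: "P (Suc n) = tl (P n)" "Q (Suc n) = Q n" if "tl (P n) \<noteq> []" for n
    using st(2)[of n] that unfolding stn nxt_def by auto
  have nx2: "hd (P (Suc n)) = Y n" "set (P (Suc n)) \<union> Q (Suc n) \<subseteq> Q n"
    "\<exists>a\<in>set (P (Suc n)). fd a = b" if "tl (P n) = []" for n b
    using st(2)[of n] that unfolding stn nxt_def by (cases b; auto)+
  define r where "r = (\<lambda>n. hd (P n))"
  \<comment> \<open>All vertices still available: \<open>W\<close> decreases and drops
    \<open>r n\<close> at step \<open>n\<close>, so no vertex recurs.\<close>
  define W where "W = (\<lambda>n. set (P n) \<union> Q n)"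
  have rP: "r n \<in> set (P n)" for n using inv(1) by (simp add: r_def)
  have W_step: "W (Suc n) \<subseteq> W n - {r n}" for n
  proof (cases "tl (P n) = []")
    case True
    then show ?thesis using nx2(2)[OF True] inv(5)[of n] rP[of n] by (auto simp: W_def)
  next
    case False
    obtain a q where aq: "P n = a # q" using inv(1)[of n] by (cases "P n") auto
    then show ?thesis using nx1[OF False] inv(2)[of n] inv(5)[of n] by (auto simp: W_def r_def)
  qed
  have W_mono: "W n \<subseteq> W m" if "m \<le> n" for m n
    using that by (rule lift_Suc_antimono_le[of W, rotated]) (use W_step in blast)
  have "r m \<noteq> r n" if "m < n" for m n
  proof -
    have "r n \<in> W n" using rP by (simp add: W_def)
    then have "r n \<in> W (Suc m)" using W_mono[of "Suc m" n] that by auto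
    then show ?thesis using W_step[of m] by auto
  qed
  then have "inj r" by (metis injI linorder_neqE_nat)
  moreover have "r i \<in> D" for i using rP[of i] inv(4)[of i] by blast
  moreover have "E (r i) (r (Suc i))" for i
  proof (cases "tl (P i) = []")
    case True
    then have "last (P i) = r i" using inv(1)[of i] by (cases "P i") (auto simp: r_def)
    then show ?thesis using inv(6)[of i] nx2(1)[OF True] by (simp add: r_def)
  next
    case False
    then obtain a b q where "P i = a # b # q" by (cases "P i"; cases "tl (P i)") auto
    then show ?thesis using nx1(1)[OF False] inv(3)[of i] by (simp add: r_def)
  qed
  moreover have "infinite {i. fd (r i) = b}" for b
    unfolding infinite_nat_iff_unbounded_le
  proof
    fix m
    have dr: "j < length (P n) \<Longrightarrow> P (n + j) = drop j (P n)" for n j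
    proof (induction j)
      case (Suc j)
      then have "P (n + j) = drop j (P n)" by simp
      moreover have "tl (drop j (P n)) = drop (Suc j) (P n)" by (simp add: drop_Suc tl_drop)
      ultimately show ?case using nx1(1)[of "n + j"] Suc.prems by simp
    qed simp
    \<comment> \<open>The moment when only the last vertex of the path current at \<open>m\<close>
      is left; the next path then contains both types.\<close>
    define n where "n = m + (length (P m) - 1)"
    have "P n = drop (length (P m) - 1) (P m)" unfolding n_def using inv(1)[of m] by (intro dr) simp
    then have "length (P n) = 1" using inv(1)[of m] by (simp add: Suc_leI)
    then have "tl (P n) = []" by (cases "P n") auto
    then obtain a where a: "a \<in> set (P (Suc n))" "fd a = b" using nx2(3) by blast
    then obtain j where j: "j < length (P (Suc n))" "P (Suc n) ! j = a" by (auto simp: in_set_conv_nth)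
    then have "r (Suc n + j) = a" using dr[OF j(1)] by (simp add: r_def hd_drop_conv_nth)
    then show "\<exists>k\<ge>m. k \<in> {i. fd (r i) = b}" using a(2) by (intro exI[of _ "Suc n + j"]) (auto simp: n_def)
  qed
  from this[of True] this[of False] have "infinite {i. fd (r i)}" "infinite {i. \<not> fd (r i)}" by auto
  ultimately show ?thesis by blast
qed

text \<open>Some component of \<open>V\<close> is unsolvable, since solutions on all components
  could be combined; removing the empty set shows that it is obstructed.\<close>

lemma not_solvable_imp_alternating:
  assumes "countable V" "\<not> solvable V"
  shows "\<exists>r::nat \<Rightarrow> 'a. inj r \<and> (\<forall>i. r i \<in> V \<and> E (r i) (r (Suc i))) \<and>
    infinite {i. fd (r i)} \<and> infinite {i. \<not> fd (r i)}"
proof -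
  have "component V u = component V w" if "u \<in> V" "w \<in> V" "w \<in> N u" for u w
    using that by (intro component_eq reach_step[of V u u w]) (auto simp: nbhd_def)
  then obtain i where i: "\<not> solvable {u \<in> V. component V u = i}"
    using solvable_labels[of V "component V"] assms(2) by blast
  then obtain u where u: "u \<in> V" "component V u = i"
  proof -
    have "{u \<in> V. component V u = i} \<noteq> {}" using i solvable_empty by metis
    then show thesis using that by blast
  qed
  have "{u \<in> V. component V u = i} = i - {}"
  proof
    show "{u \<in> V. component V u = i} \<subseteq> i - {}" using component_self by blast
    show "i - {} \<subseteq> {u \<in> V. component V u = i}"
    proof
      fix z assume "z \<in> i - {}"
      then have "reach V u z" using u(2) by (auto simp: component_def)
      then show "z \<in> {u \<in> V. component V u = i}" using component_eq reach_in u by blast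
    qed
  qed
  then have "\<not> hereditarily_solvable i" using i by (metis finite.emptyI hereditarily_solvable_def)
  then have "obstructed i u" using obstructed_component[OF u(1) assms(1)] u(2) by simp
  then show ?thesis using obstructed_imp_alternating[of i u] component_subset[OF u(1)] u(2) by blast
qed

end

section \<open>Back to the graph with the finite part attached\<close>

theorem theorem3p1:
  fixes VG VK :: "'a set"
    and EG EK EH :: "'a \<Rightarrow> 'a \<Rightarrow> bool"
    and cK :: "'a \<Rightarrow> bool"
  assumes G: "graph VG EG" and K: "graph VK EK"
    and disj: "VG \<inter> VK = {}"
    and cntG: "countable VG" and finK: "finite VK"
    and noray: "\<not> (\<exists>r. alternating_ray VG EG r)"
    and H: "graph (VG \<union> VK) EH"
    and HG: "\<And>u v. u \<in> VG \<Longrightarrow> v \<in> VG \<Longrightarrow> EH u v \<longleftrightarrow> EG u v"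
    and HK: "\<And>u v. u \<in> VK \<Longrightarrow> v \<in> VK \<Longrightarrow> EH u v \<longleftrightarrow> EK u v"
  shows "\<exists>c. (\<forall>v\<in>VK. c v = cK v) \<and> strongly_maximal EH c VG \<and>
             (\<forall>v\<in>VG. \<not> finite_deg EH v \<longrightarrow> unfriendly_at EH c v)"
proof -
  interpret sym_graph EH using H by unfold_locales (auto simp: graph_def)
  have NV: "N v \<subseteq> VG \<union> VK" for v using H by (auto simp: graph_def nbhd_def)
  \<comment> \<open>Attaching the finite set \<open>VK\<close> adds only finitely many neighbors, so
    an alternating ray of \<open>EH\<close> inside \<open>VG\<close> would be one of
    \<open>EG\<close>.\<close>
  have fd_eq: "finite_deg EG v = fd v" if v: "v \<in> VG" for v
  proof -
    have "nbhd EG v = N v \<inter> VG" using G HG v by (auto simp: graph_def nbhd_def)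
    moreover have "N v = (N v \<inter> VG) \<union> (N v \<inter> VK)" using NV by blast
    then have "finite (N v) \<longleftrightarrow> finite (N v \<inter> VG)" using finK by (metis finite_Int finite_Un)
    ultimately show ?thesis by (simp add: finite_deg_def)
  qed
  have "solvable VG"
  proof (rule ccontr)
    assume "\<not> solvable VG"
    then obtain r where "inj r" "\<forall>i::nat. r i \<in> VG \<and> EH (r i) (r (Suc i))"
      "infinite {i. fd (r i)}" "infinite {i. \<not> fd (r i)}"
      using not_solvable_imp_alternating[OF cntG] by blast
    then have "alternating_ray VG EG r"
      unfolding alternating_ray_def using fd_eq by (simp flip: HG)
    then show False using noray by blast
  qed
  then obtain c where c: "\<And>v. v \<notin> VG \<Longrightarrow> c v = cK v" "strongly_maximal EH c VG"
    "\<And>l. l \<in> VG \<Longrightarrow> happy VG c l" using solvableE[of VG cK] by metis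
  have "unfriendly_at EH c v" if v: "v \<in> VG" "\<not> fd v" for v
  proof -
    \<comment> \<open>Infinitely many neighbors of \<open>v\<close> lie in \<open>VG\<close>, so
      \<open>happy\<close> yields infinitely many opposite ones and the left side of
      \<open>unfriendly_at\<close> is \<open>\<infinity>\<close>.\<close>
    have "N v \<subseteq> (N v \<inter> VG) \<union> VK" using NV by blast
    then have "infinite (N v \<inter> VG)" using v(2) finK by (meson finite_UnI finite_deg_def finite_subset)
    then have "infinite {u \<in> N v \<inter> VG. c u \<noteq> c v}" using c(3)[OF v(1)] by (simp add: happy_def)
    moreover have "{u \<in> N v \<inter> VG. c u \<noteq> c v} \<subseteq> {u \<in> N v. c u \<noteq> c v}" by auto
    ultimately have "infinite {u \<in> N v. c u \<noteq> c v}" by (rule infinite_super[rotated])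
    then show ?thesis by (simp add: unfriendly_at_def ecard_def)
  qed
  moreover have "\<forall>v\<in>VK. c v = cK v" using c(1) disj by blast
  ultimately show ?thesis using c(2) by blast
qed

end
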